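(* Let $X$ be a connected complex manifold, let $f:X\to X$ be holomorphic, let $u\in\mathcal{O}(X)$, and let $V\subset\mathcal{O}(X)$ be a quasi-Banach space with continuous inclusion. Let $p\in X$ be a periodic point of $f$ with period $r\ge 1$, and put $u_r:=\prod_{j=0}^{r-1}u\circ f^j$. Assume that $uC_f$ is a bounded (resp. compact) linear operator on $V$, that $u_r(p)\ne 0$, and that $$\operatorname{Im}\,\mathrm{gr}_p^n\bigl(u_r(f^r)^*\bigr)\subset V_{p,n}/V_{p,n+1}\qquad\text{for infinitely many } n\ge 1.$$ Then every eigenvalue $\alpha$ of the Jacobian matrix $\mathrm{d}(f^r)_p:T_p^{1,0}X\to T_p^{1,0}X$ satisfies $|\alpha|\le 1$ (resp. $|\alpha|<1$).
   Context: $\mathcal{O}(X)$ is the space of holomorphic functions on $X$ with the topology of uniform convergence on compact sets; $\mathcal{O}_{X,p}$ is the ring of germs of holomorphic functions at $p$, with maximal ideal $\mathfrak{m}_p$ of germs vanishing at $p$ ($\mathfrak{m}_p^0=\mathcal{O}_{X,p}$). A quasi-Banach space is a complete Hausdorff topological vector space whose topology is given by a quasi-norm: a map $\|\cdot\|_V:V\to\mathbb{R}_{\ge0}$ with $\|av\|_V=|a|\|v\|_V$, $\|v+w\|_V\le K(\|v\|_V+\|w\|_V)$ for some $K\ge1$ independent of $v,w$, and $\|v\|_V=0\Rightarrow v=0$. "$V\subset\mathcal{O}(X)$ with continuous inclusion" means $V$ is a complex linear subspace of $\mathcal{O}(X)$, with its own topology, such that the inclusion $V\hookrightarrow\mathcal{O}(X)$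 is continuous. The weighted composition operator $uC_f$ on $V$ is $h\mapsto u\cdot(h\circ f)$ with domain $\{h\in V:u\cdot(h\circ f)\in V\}$; it is bounded (resp. compact) on $V$ if its domain is all of $V$ and it is a bounded (resp. compact) operator $V\to V$. Here $f^j$ is the $j$-th iterate of $f$. For $n\ge0$, $V_{p,n}$ is the set of $h\in V$ whose germ at $p$ lies in $\mathfrak{m}_p^n$ (i.e. all Taylor coefficients at $p$ of total degree $<n$ vanish). The quotient $V_{p,n}/V_{p,n+1}$ is naturally regarded as a subspace of $\mathfrak{m}_p^n/\mathfrak{m}_p^{n+1}$. For holomorphic $g:X\to X$ and $w\in\mathcal{O}(X)$, the weighted pull-back $wg^*(h)=w\cdot(h\circ g)$ maps $\mathfrak{m}_{g(p)}^n$ into $\mathfrak{m}_p^n$ and induces a linear map $\mathrm{gr}_p^n(wg^* ):\mathfrak{m}_{g(p)}^n/\mathfrak{m}_{g(p)}^{n+1}\to\mathfrak{m}_p^n/\mathfrak{m}_p^{n+1}$. (For $g=f^r$ one has $g(p)=p$.) *)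

theory Defs
  imports "HOL-Analysis.Analysis" "HOL-Algebra.Ideal_Product" "HOL-Algebra.QuotRing"
begin

section \<open>Complex manifolds and holomorphic maps\<close>

text \<open>
  Holomorphy in several variables on an open set: at every point there is a Frechet derivative
  that is complex linear.  On \<open>complex ^ 'n\<close> the complex scalar multiplication is \<open>*s\<close>.
\<close>

definition holomorphic_several :: "(complex ^ 'n \<Rightarrow> complex) \<Rightarrow> (complex ^ 'n) set \<Rightarrow> bool" where
  "holomorphic_several g S \<longleftrightarrow>
     (\<forall>z\<in>S. \<exists>D. (g has_derivative D) (at z) \<and> (\<forall>c v. D (c *s v) = c * D v))"

text \<open>
  A chart is a pair of its domain and its coordinate map; only the values of the coordinate map
  on the domain matter.  The points of the manifold are all elements of the type \<open>'a\<close>.  Manifolds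
  are Hausdorff; no countability axiom is imposed.
\<close>

type_synonym ('a, 'n) atlas = "('a set \<times> ('a \<Rightarrow> complex ^ 'n)) set"

definition complex_manifold :: "('a::t2_space, 'n::finite) atlas \<Rightarrow> bool" where
  "complex_manifold A \<longleftrightarrow>
     (\<forall>(U, \<phi>)\<in>A. open U \<and> open (\<phi> ` U) \<and> homeomorphism U (\<phi> ` U) \<phi> (inv_into U \<phi>)) \<and>
     (\<Union>(U, \<phi>)\<in>A. U) = UNIV \<and>
     (\<forall>(U, \<phi>)\<in>A. \<forall>(W, \<psi>)\<in>A. \<forall>i.
        holomorphic_several (\<lambda>z. \<psi> (inv_into U \<phi> z) $ i) (\<phi> ` (U \<inter> W)))"

definition holomorphic_fun_on ::
    "('a::t2_space, 'n::finite) atlas \<Rightarrow> 'a set \<Rightarrow> ('a \<Rightarrow> complex) \<Rightarrow> bool" where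
  "holomorphic_fun_on A W h \<longleftrightarrow>
     (\<forall>(U, \<phi>)\<in>A. holomorphic_several (\<lambda>z. h (inv_into U \<phi> z)) (\<phi> ` (U \<inter> W)))"

definition hol_funs :: "('a::t2_space, 'n::finite) atlas \<Rightarrow> ('a \<Rightarrow> complex) set" where
  "hol_funs A = {h. holomorphic_fun_on A UNIV h}"

definition holomorphic_self_map ::
    "('a::t2_space, 'n::finite) atlas \<Rightarrow> ('a \<Rightarrow> 'a) \<Rightarrow> bool" where
  "holomorphic_self_map A f \<longleftrightarrow>
     continuous_on UNIV f \<and>
     (\<forall>(U, \<phi>)\<in>A. \<forall>(W, \<psi>)\<in>A. \<forall>i.
        holomorphic_several (\<lambda>z. \<psi> (f (inv_into U \<phi> z)) $ i) (\<phi> ` (U \<inter> f -` W)))"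

text \<open>
  The Jacobian matrix at a fixed point \<open>p\<close> of \<open>g\<close> in a chart around \<open>p\<close>, that is, the matrix of
  the differential in the basis \<open>\<partial>/\<partial>z\<^sub>j\<close> of the holomorphic tangent space at \<open>p\<close>.  The library's
  \<^const>\<open>jacobian\<close> takes the real Frechet derivative and evaluates it at the complex unit vectors;
  for holomorphic maps this derivative is complex linear, so the entries are the complex partial
  derivatives.
\<close>

definition chart_jacobian ::
    "('a::t2_space set \<times> ('a \<Rightarrow> complex ^ 'n::finite)) \<Rightarrow> ('a \<Rightarrow> 'a) \<Rightarrow> 'a \<Rightarrow> complex ^ 'n ^ 'n" where
  "chart_jacobian c g p =
     (case c of (U, \<phi>) \<Rightarrow> jacobian (\<lambda>z. \<phi> (g (inv_into U \<phi> z))) (at (\<phi> p)))"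

definition matrix_eigenvalue :: "complex ^ 'n ^ 'n \<Rightarrow> complex \<Rightarrow> bool" where
  "matrix_eigenvalue M \<alpha> \<longleftrightarrow> (\<exists>v. v \<noteq> 0 \<and> M *v v = \<alpha> *s v)"


section \<open>Spaces of holomorphic functions\<close>

definition compact_conv_topology ::
    "('a::t2_space, 'n::finite) atlas \<Rightarrow> ('a \<Rightarrow> complex) topology" where
  "compact_conv_topology A = topology (\<lambda>\<U>. \<U> \<subseteq> hol_funs A \<and>
     (\<forall>h\<in>\<U>. \<exists>K e. compact K \<and> e > 0 \<and>
        {g \<in> hol_funs A. \<forall>x\<in>K. cmod (g x - h x) < e} \<subseteq> \<U>))"

lemma openin_compact_conv_topology:
  "openin (compact_conv_topology A) \<U> \<longleftrightarrow> \<U> \<subseteq> hol_funs A \<and>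
     (\<forall>h\<in>\<U>. \<exists>K e. compact K \<and> e > 0 \<and>
        {g \<in> hol_funs A. \<forall>x\<in>K. cmod (g x - h x) < e} \<subseteq> \<U>)"
proof -
  let ?P = "\<lambda>\<U>. \<U> \<subseteq> hol_funs A \<and> (\<forall>h\<in>\<U>. \<exists>K e. compact K \<and> e > 0 \<and>
        {g \<in> hol_funs A. \<forall>x\<in>K. cmod (g x - h x) < e} \<subseteq> \<U>)"
  have "istopology ?P"
    unfolding istopology_def
  proof (intro conjI allI impI)
    fix S T assume S: "?P S" and T: "?P T"
    show "S \<inter> T \<subseteq> hol_funs A" using S by blast
    show "\<forall>h\<in>S \<inter> T. \<exists>K e. compact K \<and> e > 0 \<and>
        {g \<in> hol_funs A. \<forall>x\<in>K. cmod (g x - h x) < e} \<subseteq> S \<inter> T"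
    proof
      fix h assume h: "h \<in> S \<inter> T"
      obtain K e where 1: "compact K" "(e::real) > 0"
        "{g \<in> hol_funs A. \<forall>x\<in>K. cmod (g x - h x) < e} \<subseteq> S"
        using S h by blast
      obtain L d where 2: "compact L" "(d::real) > 0"
        "{g \<in> hol_funs A. \<forall>x\<in>L. cmod (g x - h x) < d} \<subseteq> T"
        using T h by blast
      have "{g \<in> hol_funs A. \<forall>x\<in>K \<union> L. cmod (g x - h x) < min e d} \<subseteq> S \<inter> T"
        using 1(3) 2(3) by auto
      then show "\<exists>K e. compact K \<and> e > 0 \<and>
        {g \<in> hol_funs A. \<forall>x\<in>K. cmod (g x - h x) < e} \<subseteq> S \<inter> T"
        using 1 2 by (intro exI[of _ "K \<union> L"] exI[of _ "min e d"]) auto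
    qed
  next
    fix \<K> assume K: "\<forall>S\<in>\<K>. ?P S"
    show "\<Union>\<K> \<subseteq> hol_funs A" using K by blast
    show "\<forall>h\<in>\<Union>\<K>. \<exists>K e. compact K \<and> e > 0 \<and>
        {g \<in> hol_funs A. \<forall>x\<in>K. cmod (g x - h x) < e} \<subseteq> \<Union>\<K>"
    proof
      fix h assume "h \<in> \<Union>\<K>"
      then obtain S where S: "S \<in> \<K>" "h \<in> S" by blast
      then obtain K e where "compact K" "(e::real) > 0"
        "{g \<in> hol_funs A. \<forall>x\<in>K. cmod (g x - h x) < e} \<subseteq> S"
        using K by meson
      moreover have "S \<subseteq> \<Union>\<K>" using S by blast
      ultimately show "\<exists>K e. compact K \<and> e > 0 \<and>
        {g \<in> hol_funs A. \<forall>x\<in>K. cmod (g x - h x) < e} \<subseteq> \<Union>\<K>"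
        by (meson subset_trans)
    qed
  qed
  then show ?thesis
    by (simp add: compact_conv_topology_def topology_inverse')
qed

definition complex_function_space :: "('a \<Rightarrow> complex) set \<Rightarrow> bool" where
  "complex_function_space V \<longleftrightarrow>
     (\<lambda>x. 0) \<in> V \<and>
     (\<forall>h\<in>V. \<forall>k\<in>V. (\<lambda>x. h x + k x) \<in> V) \<and>
     (\<forall>a. \<forall>h\<in>V. (\<lambda>x. a * h x) \<in> V)"

definition quasi_norm_on :: "('a \<Rightarrow> complex) set \<Rightarrow> (('a \<Rightarrow> complex) \<Rightarrow> real) \<Rightarrow> bool" where
  "quasi_norm_on V N \<longleftrightarrow>
     (\<forall>h\<in>V. N h \<ge> 0) \<and>
     (\<forall>a. \<forall>h\<in>V. N (\<lambda>x. a * h x) = cmod a * N h) \<and>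
     (\<exists>K\<ge>1. \<forall>h\<in>V. \<forall>k\<in>V. N (\<lambda>x. h x + k x) \<le> K * (N h + N k)) \<and>
     (\<forall>h\<in>V. N h = 0 \<longrightarrow> h = (\<lambda>x. 0))"

text \<open>
  Balls of a quasi-norm need not be open.  The topology given by a quasi-norm is the one in which
  the balls around a point form a neighbourhood base of that point.
\<close>

definition quasi_norm_topology ::
    "('a \<Rightarrow> complex) set \<Rightarrow> (('a \<Rightarrow> complex) \<Rightarrow> real) \<Rightarrow> ('a \<Rightarrow> complex) topology" where
  "quasi_norm_topology V N = topology (\<lambda>\<U>. \<U> \<subseteq> V \<and>
     (\<forall>h\<in>\<U>. \<exists>e>0. {g \<in> V. N (\<lambda>x. g x - h x) < e} \<subseteq> \<U>))"

lemma openin_quasi_norm_topology: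
  "openin (quasi_norm_topology V N) \<U> \<longleftrightarrow> \<U> \<subseteq> V \<and>
     (\<forall>h\<in>\<U>. \<exists>e>0. {g \<in> V. N (\<lambda>x. g x - h x) < e} \<subseteq> \<U>)"
proof -
  let ?P = "\<lambda>\<U>. \<U> \<subseteq> V \<and> (\<forall>h\<in>\<U>. \<exists>e>0. {g \<in> V. N (\<lambda>x. g x - h x) < e} \<subseteq> \<U>)"
  have "istopology ?P"
    unfolding istopology_def
  proof (intro conjI allI impI)
    fix S T assume S: "?P S" and T: "?P T"
    show "S \<inter> T \<subseteq> V" using S by blast
    show "\<forall>h\<in>S \<inter> T. \<exists>e>0. {g \<in> V. N (\<lambda>x. g x - h x) < e} \<subseteq> S \<inter> T"
    proof
      fix h assume h: "h \<in> S \<inter> T"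
      obtain e where 1: "(e::real) > 0" "{g \<in> V. N (\<lambda>x. g x - h x) < e} \<subseteq> S"
        using S h by blast
      obtain d where 2: "(d::real) > 0" "{g \<in> V. N (\<lambda>x. g x - h x) < d} \<subseteq> T"
        using T h by blast
      show "\<exists>e>0. {g \<in> V. N (\<lambda>x. g x - h x) < e} \<subseteq> S \<inter> T"
        using 1 2 by (intro exI[of _ "min e d"]) auto
    qed
  next
    fix \<K> assume K: "\<forall>S\<in>\<K>. ?P S"
    show "\<Union>\<K> \<subseteq> V" using K by blast
    show "\<forall>h\<in>\<Union>\<K>. \<exists>e>0. {g \<in> V. N (\<lambda>x. g x - h x) < e} \<subseteq> \<Union>\<K>"
      using K by (meson Union_iff Union_upper subset_trans)
  qed
  then show ?thesis
    by (simp add: quasi_norm_topology_def topology_inverse')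
qed

text \<open>
  The Hausdorff property follows from the definiteness of the quasi-norm.  The topology is
  metrizable, so completeness may be stated with sequences.
\<close>

definition quasi_Banach :: "('a \<Rightarrow> complex) set \<Rightarrow> (('a \<Rightarrow> complex) \<Rightarrow> real) \<Rightarrow> bool" where
  "quasi_Banach V N \<longleftrightarrow>
     complex_function_space V \<and> quasi_norm_on V N \<and>
     (\<forall>s. (\<forall>n. s n \<in> V) \<and>
          (\<forall>e>0. \<exists>M. \<forall>m\<ge>M. \<forall>n\<ge>M. N (\<lambda>x. s m x - s n x) < e) \<longrightarrow>
        (\<exists>h\<in>V. (\<lambda>n::nat. N (\<lambda>x. s n x - h x)) \<longlonglongrightarrow> 0))"

definition continuous_inclusion ::
    "('a::t2_space, 'n::finite) atlas \<Rightarrow> ('a \<Rightarrow> complex) set \<Rightarrow> (('a \<Rightarrow> complex) \<Rightarrow> real) \<Rightarrow> bool" where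
  "continuous_inclusion A V N \<longleftrightarrow>
     V \<subseteq> hol_funs A \<and>
     continuous_map (quasi_norm_topology V N) (compact_conv_topology A) (\<lambda>h. h)"


section \<open>Weighted composition operators\<close>

definition wcomp :: "('a \<Rightarrow> complex) \<Rightarrow> ('a \<Rightarrow> 'a) \<Rightarrow> ('a \<Rightarrow> complex) \<Rightarrow> 'a \<Rightarrow> complex" where
  "wcomp u f h = (\<lambda>x. u x * h (f x))"

definition wcomp_domain ::
    "('a \<Rightarrow> complex) set \<Rightarrow> ('a \<Rightarrow> complex) \<Rightarrow> ('a \<Rightarrow> 'a) \<Rightarrow> ('a \<Rightarrow> complex) set" where
  "wcomp_domain V u f = {h \<in> V. wcomp u f h \<in> V}"

definition wcomp_bounded ::
    "('a \<Rightarrow> complex) set \<Rightarrow> (('a \<Rightarrow> complex) \<Rightarrow> real) \<Rightarrow> ('a \<Rightarrow> complex) \<Rightarrow> ('a \<Rightarrow> 'a) \<Rightarrow> bool" where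
  "wcomp_bounded V N u f \<longleftrightarrow>
     wcomp_domain V u f = V \<and> (\<exists>C. \<forall>h\<in>V. N (wcomp u f h) \<le> C * N h)"

definition wcomp_compact ::
    "('a \<Rightarrow> complex) set \<Rightarrow> (('a \<Rightarrow> complex) \<Rightarrow> real) \<Rightarrow> ('a \<Rightarrow> complex) \<Rightarrow> ('a \<Rightarrow> 'a) \<Rightarrow> bool" where
  "wcomp_compact V N u f \<longleftrightarrow>
     wcomp_domain V u f = V \<and>
     compactin (quasi_norm_topology V N)
       (quasi_norm_topology V N closure_of (wcomp u f ` {h \<in> V. N h \<le> 1}))"


section \<open>Germs and the filtration by powers of the maximal ideal\<close>

text \<open>
  A germ is the set of all total functions that agree near \<open>p\<close> with a given function.  A function
  on a neighbourhood of \<open>p\<close> is represented by any of its extensions to the whole type.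
\<close>

definition germ_at :: "'a::topological_space \<Rightarrow> ('a \<Rightarrow> complex) \<Rightarrow> ('a \<Rightarrow> complex) set" where
  "germ_at p h = {g. \<forall>\<^sub>F x in nhds p. g x = h x}"

definition hol_germs :: "('a::t2_space, 'n::finite) atlas \<Rightarrow> 'a \<Rightarrow> ('a \<Rightarrow> complex) set set" where
  "hol_germs A p = {germ_at p h | h W. open W \<and> p \<in> W \<and> holomorphic_fun_on A W h}"

definition germ_ring :: "('a::t2_space, 'n::finite) atlas \<Rightarrow> 'a \<Rightarrow> ('a \<Rightarrow> complex) set ring" where
  "germ_ring A p =
     \<lparr> carrier = hol_germs A p,
       mult = (\<lambda>a b. {k. \<exists>g\<in>a. \<exists>h\<in>b. \<forall>\<^sub>F x in nhds p. k x = g x * h x}),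
       one = germ_at p (\<lambda>x. 1),
       zero = germ_at p (\<lambda>x. 0),
       add = (\<lambda>a b. {k. \<exists>g\<in>a. \<exists>h\<in>b. \<forall>\<^sub>F x in nhds p. k x = g x + h x}) \<rparr>"

definition max_ideal :: "('a::t2_space, 'n::finite) atlas \<Rightarrow> 'a \<Rightarrow> ('a \<Rightarrow> complex) set set" where
  "max_ideal A p = {a \<in> hol_germs A p. \<forall>h\<in>a. h p = 0}"

primrec max_ideal_pow ::
    "('a::t2_space, 'n::finite) atlas \<Rightarrow> 'a \<Rightarrow> nat \<Rightarrow> ('a \<Rightarrow> complex) set set" where
  "max_ideal_pow A p 0 = carrier (germ_ring A p)"
| "max_ideal_pow A p (Suc n) = ideal_prod (germ_ring A p) (max_ideal A p) (max_ideal_pow A p n)"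

text \<open>The quotient of the \<open>n\<close>-th power of the maximal ideal by the next power, as a set of cosets.\<close>

definition gr_space ::
    "('a::t2_space, 'n::finite) atlas \<Rightarrow> 'a \<Rightarrow> nat \<Rightarrow> ('a \<Rightarrow> complex) set set set" where
  "gr_space A p n = (\<lambda>a. max_ideal_pow A p (Suc n) +>\<^bsub>germ_ring A p\<^esub> a) ` max_ideal_pow A p n"

definition germ_wpull ::
    "'a::topological_space \<Rightarrow> ('a \<Rightarrow> complex) \<Rightarrow> ('a \<Rightarrow> 'a) \<Rightarrow> ('a \<Rightarrow> complex) set \<Rightarrow> ('a \<Rightarrow> complex) set"
  where
  "germ_wpull p w g a = {k. \<exists>h\<in>a. \<forall>\<^sub>F x in nhds p. k x = w x * h (g x)}"

text \<open>
  The induced map on cosets, taking the coset of a germ \<open>a\<close> at \<open>g p\<close> to the coset of the weighted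
  pull-back of \<open>a\<close>.  Written without choosing a representative: the weighted pull-backs of all
  elements of a coset lie in one coset, which is recovered by adding the ideal.
\<close>

definition gr_map ::
    "('a::t2_space, 'n::finite) atlas \<Rightarrow> 'a \<Rightarrow> nat \<Rightarrow> ('a \<Rightarrow> complex) \<Rightarrow> ('a \<Rightarrow> 'a) \<Rightarrow>
     ('a \<Rightarrow> complex) set set \<Rightarrow> ('a \<Rightarrow> complex) set set" where
  "gr_map A p n w g C = max_ideal_pow A p (Suc n) <+>\<^bsub>germ_ring A p\<^esub> (germ_wpull p w g ` C)"

definition V_filt ::
    "('a::t2_space, 'n::finite) atlas \<Rightarrow> ('a \<Rightarrow> complex) set \<Rightarrow> 'a \<Rightarrow> nat \<Rightarrow> ('a \<Rightarrow> complex) set" where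
  "V_filt A V p n = {h \<in> V. germ_at p h \<in> max_ideal_pow A p n}"

text \<open>
  The quotient of \<open>V_filt A V p n\<close> by \<open>V_filt A V p (Suc n)\<close>, regarded as a subspace of
  \<open>gr_space A p n\<close>: the class of \<open>h\<close> is identified with the coset of its germ.
\<close>

definition V_gr ::
    "('a::t2_space, 'n::finite) atlas \<Rightarrow> ('a \<Rightarrow> complex) set \<Rightarrow> 'a \<Rightarrow> nat \<Rightarrow>
     ('a \<Rightarrow> complex) set set set" where
  "V_gr A V p n =
     (\<lambda>h. max_ideal_pow A p (Suc n) +>\<^bsub>germ_ring A p\<^esub> germ_at p h) ` V_filt A V p n"

end

theory Submission
  imports Defs "HOL-Complex_Analysis.Conformal_Mappings"
begin

text \<open>
  Write \<open>g = f\<^sup>r\<close>, \<open>w = u\<^sub>r\<close> and \<open>T = (u C\<^sub>f)\<^sup>r\<close>.  Then \<open>T h = w \<cdot> (h \<circ> g)\<close>, and \<open>p\<close> is a fixed point of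
  \<open>g\<close>.  Let \<open>v\<close> be an eigenvector of \<open>dg\<^sub>p\<close> for the eigenvalue \<open>\<alpha> \<noteq> 0\<close>.  If \<open>h\<close> vanishes to order \<open>n\<close> at
  \<open>p\<close>, let \<open>L\<^sub>n h\<close> be the coefficient of \<open>t\<^sup>n\<close> of \<open>h\<close> on the complex line \<open>p + t v\<close> in a chart.

  On this line \<open>g\<close> acts like \<open>t \<mapsto> \<alpha> t\<close> up to \<open>o(t)\<close>.  Since the derivative of \<open>h\<close> is \<open>O(|z|\<^sup>n\<^sup>-\<^sup>1)\<close> by
  Cauchy's estimate, the error does not affect the coefficient of \<open>t\<^sup>n\<close>, and therefore
  \<open>L\<^sub>n (T h) = w(p) \<alpha>\<^sup>n L\<^sub>n h\<close> (\<open>leading_wcomp\<close>).  Each \<open>L\<^sub>n\<close> is bounded on the functions in \<open>V\<close> that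
  vanish to order \<open>n\<close>, by Cauchy's estimate and the continuity of the inclusion
  (\<open>leading_Cauchy_bound\<close>, \<open>continuous_inclusion_sup_bound\<close>).  The hypothesis on the graded pieces
  is applied to the class of \<open>(z\<^sub>i - z\<^sub>i(p))\<^sup>n\<close> for a coordinate with \<open>v\<^sub>i \<noteq> 0\<close>: its image is the class of
  an element of \<open>V\<close> on which \<open>L\<^sub>n\<close> takes the value \<open>w(p) (\<alpha> v\<^sub>i)\<^sup>n \<noteq> 0\<close>, so for infinitely many \<open>n\<close> the
  functional \<open>L\<^sub>n\<close> is not zero (\<open>exists_leading_nonzero\<close>).

  Now compare norms.  If \<open>T\<close> is bounded, a function that almost realises the norm of \<open>L\<^sub>n\<close> shows that
  \<open>|w(p) \<alpha>\<^sup>n|\<close> is bounded independently of \<open>n\<close>, so \<open>|\<alpha>| \<le> 1\<close> (\<open>bounded_imp_eigenvalue_bound\<close>).  If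
  \<open>u C\<^sub>f\<close> is compact and \<open>|\<alpha>| \<ge> 1\<close>, choose such a function \<open>h\<^sub>n\<close> in the unit ball for each of these \<open>n\<close>.  For
  \<open>m > n\<close> the function \<open>T h\<^sub>m\<close> vanishes to order \<open>m\<close>, so \<open>L\<^sub>n\<close> does not see it, and \<open>L\<^sub>n\<close> separates
  \<open>T h\<^sub>n\<close> from \<open>T h\<^sub>m\<close> by a constant multiple of \<open>|w(p)|\<close>
  (\<open>compact_imp_finitely_many_large_eigenvalues\<close>).  No sequence in a compact set is separated in
  this way (\<open>compactin_quasi_norm_not_separated\<close>).
\<close>

section \<open>Quasi-normed function spaces\<close>

lemma complex_function_space_zero: "complex_function_space V \<Longrightarrow> (\<lambda>x. 0) \<in> V"
  by (simp add: complex_function_space_def)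

lemma complex_function_space_scale:
  "complex_function_space V \<Longrightarrow> h \<in> V \<Longrightarrow> (\<lambda>x. a * h x) \<in> V"
  by (simp add: complex_function_space_def)

lemma quasi_norm_scale:
  "quasi_norm_on V N \<Longrightarrow> h \<in> V \<Longrightarrow> N (\<lambda>x. a * h x) = cmod a * N h"
  by (simp add: quasi_norm_on_def)

lemma quasi_norm_nonneg: "quasi_norm_on V N \<Longrightarrow> h \<in> V \<Longrightarrow> N h \<ge> 0"
  by (simp add: quasi_norm_on_def)

lemma quasi_norm_eq_0D: "quasi_norm_on V N \<Longrightarrow> h \<in> V \<Longrightarrow> N h = 0 \<Longrightarrow> h = (\<lambda>x. 0)"
  by (simp add: quasi_norm_on_def)

lemma quasi_norm_pos:
  "quasi_norm_on V N \<Longrightarrow> h \<in> V \<Longrightarrow> N h \<noteq> 0 \<Longrightarrow> N h > 0"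
  using quasi_norm_nonneg by fastforce

lemma complex_function_space_diff:
  assumes "complex_function_space V" "h \<in> V" "k \<in> V"
  shows "(\<lambda>x. h x - k x) \<in> V"
proof -
  have "(\<lambda>x. (-1) * k x) \<in> V"
    using complex_function_space_scale[OF assms(1,3)] .
  then have "(\<lambda>x. h x + (-1) * k x) \<in> V"
    using assms unfolding complex_function_space_def by fastforce
  then show ?thesis by simp
qed

lemma quasi_norm_minus_commute:
  assumes "complex_function_space V" "quasi_norm_on V N" "h \<in> V" "k \<in> V"
  shows "N (\<lambda>x. h x - k x) = N (\<lambda>x. k x - h x)"
proof -
  have "N (\<lambda>x. (-1) * (k x - h x)) = cmod (-1) * N (\<lambda>x. k x - h x)"
    using quasi_norm_scale[OF assms(2) complex_function_space_diff[OF assms(1,4,3)]] .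
  then show ?thesis by simp
qed

lemma quasi_norm_diff_triangle:
  assumes "complex_function_space V" "quasi_norm_on V N"
  obtains K where "K \<ge> 1"
    "\<And>h g k. h \<in> V \<Longrightarrow> g \<in> V \<Longrightarrow> k \<in> V \<Longrightarrow>
       N (\<lambda>x. h x - k x) \<le> K * (N (\<lambda>x. h x - g x) + N (\<lambda>x. g x - k x))"
proof -
  obtain K where K: "K \<ge> 1"
    "\<And>h k. h \<in> V \<Longrightarrow> k \<in> V \<Longrightarrow> N (\<lambda>x. h x + k x) \<le> K * (N h + N k)"
    using assms(2) unfolding quasi_norm_on_def by blast
  show thesis
  proof (rule that[OF K(1)])
    fix h g k assume "h \<in> V" "g \<in> V" "k \<in> V"
    then show "N (\<lambda>x. h x - k x) \<le> K * (N (\<lambda>x. h x - g x) + N (\<lambda>x. g x - k x))"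
      using K(2)[of "\<lambda>x. h x - g x" "\<lambda>x. g x - k x"] complex_function_space_diff[OF assms(1)]
      by simp
  qed
qed

text \<open>
  The ball itself need not be open.  The set of its points around which some smaller ball stays
  inside is open: dividing the radius by twice the constant of the quasi-triangle inequality
  absorbs one application of that inequality.
\<close>

lemma quasi_norm_ball_neighbourhood:
  assumes V: "complex_function_space V" "quasi_norm_on V N" and "h \<in> V" "e > 0"
  obtains W where "openin (quasi_norm_topology V N) W" "h \<in> W"
    "W \<subseteq> {g \<in> V. N (\<lambda>x. g x - h x) < e}"
proof -
  define B where "B = (\<lambda>h e. {g \<in> V. N (\<lambda>x. g x - h x) < e})"
  define W where "W = {g \<in> V. \<exists>d>0. B g d \<subseteq> B h e}"
  obtain K where K: "K \<ge> 1"
    "\<And>h g k. h \<in> V \<Longrightarrow> g \<in> V \<Longrightarrow> k \<in> V \<Longrightarrow>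
       N (\<lambda>x. h x - k x) \<le> K * (N (\<lambda>x. h x - g x) + N (\<lambda>x. g x - k x))"
    using quasi_norm_diff_triangle[OF V] by blast
  have zero: "N (\<lambda>x. 0) = 0"
    using quasi_norm_scale[OF V(2) complex_function_space_zero[OF V(1)], of 0] by simp
  have centre: "g \<in> B g d" if "g \<in> V" "d > 0" for g d
    using that zero by (simp add: B_def)
  have "\<exists>d>0. B g d \<subseteq> W" if g: "g \<in> W" for g
  proof -
    obtain d where d: "d > 0" "B g d \<subseteq> B h e" "g \<in> V" using g by (auto simp: W_def)
    define d' where "d' = d / (2 * K)"
    have d': "d' > 0" using d K by (simp add: d'_def)
    have "B g' d' \<subseteq> B g d" if g': "g' \<in> B g d'" for g'
    proof
      fix k assume k: "k \<in> B g' d'"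
      have "N (\<lambda>x. k x - g x) \<le> K * (N (\<lambda>x. k x - g' x) + N (\<lambda>x. g' x - g x))"
        using k g' d by (intro K) (auto simp: B_def)
      also have "\<dots> < K * (d' + d')"
        using k g' K(1) by (intro mult_strict_left_mono add_strict_mono) (auto simp: B_def)
      also have "\<dots> = d" using K(1) by (simp add: d'_def)
      finally show "k \<in> B g d" using k by (simp add: B_def)
    qed
    then have "B g d' \<subseteq> W" using d d' unfolding W_def by (fastforce simp: B_def)
    then show ?thesis using d' by blast
  qed
  then have "openin (quasi_norm_topology V N) W"
    by (auto simp: openin_quasi_norm_topology W_def B_def)
  moreover have "h \<in> W" using assms unfolding W_def by blast
  moreover have "W \<subseteq> B h e" using centre unfolding W_def by blast
  ultimately show thesis using that by (simp add: B_def)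
qed

text \<open>
  A neighbourhood of small diameter contains at most one member of a separated sequence, so no
  finite number of them covers the sequence.
\<close>

lemma compactin_quasi_norm_not_separated:
  assumes V: "complex_function_space V" "quasi_norm_on V N"
    and K: "compactin (quasi_norm_topology V N) Q"
    and s: "\<And>j::nat. s j \<in> Q" and "\<delta> > 0"
  shows "\<exists>j k. j < k \<and> N (\<lambda>x. s j x - s k x) < \<delta>"
proof (rule ccontr)
  assume "\<not> ?thesis"
  then have sep: "N (\<lambda>x. s j x - s k x) \<ge> \<delta>" if "j < k" for j k
    using that by (meson not_less)
  have top: "topspace (quasi_norm_topology V N) \<subseteq> V"
    using openin_topspace openin_quasi_norm_topology by metis
  then have QV: "Q \<subseteq> V" using K by (auto simp: compactin_def)
  obtain K where K1: "K \<ge> 1"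
    "\<And>h g k. h \<in> V \<Longrightarrow> g \<in> V \<Longrightarrow> k \<in> V \<Longrightarrow>
       N (\<lambda>x. h x - k x) \<le> K * (N (\<lambda>x. h x - g x) + N (\<lambda>x. g x - k x))"
    using quasi_norm_diff_triangle[OF V] by blast
  define e where "e = \<delta> / (2 * K)"
  have e: "e > 0" using assms K1 by (simp add: e_def)
  define \<U> where "\<U> = {W. openin (quasi_norm_topology V N) W \<and>
     (\<exists>h\<in>V. W \<subseteq> {g \<in> V. N (\<lambda>x. g x - h x) < e})}"
  have "Q \<subseteq> \<Union>\<U>"
  proof
    fix h assume "h \<in> Q"
    then have hV: "h \<in> V" using QV by blast
    obtain W where "openin (quasi_norm_topology V N) W" "h \<in> W"
      "W \<subseteq> {g \<in> V. N (\<lambda>x. g x - h x) < e}"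
      using quasi_norm_ball_neighbourhood[OF V hV e] .
    then show "h \<in> \<Union>\<U>" using hV unfolding \<U>_def by blast
  qed
  moreover have "\<forall>W\<in>\<U>. openin (quasi_norm_topology V N) W" by (simp add: \<U>_def)
  ultimately obtain \<F> where F: "finite \<F>" "\<F> \<subseteq> \<U>" "Q \<subseteq> \<Union>\<F>"
    using K unfolding compactin_def by meson
  have "\<exists>W. W \<in> \<F> \<and> s j \<in> W" for j using F(3) s by blast
  then obtain w where w: "\<And>j. w j \<in> \<F>" "\<And>j. s j \<in> w j" by metis
  have "w j \<noteq> w k" if jk: "j < k" for j k
  proof
    assume "w j = w k"
    moreover have "w j \<in> \<U>" using w(1) F(2) by blast
    then obtain h where hV: "h \<in> V" "w j \<subseteq> {g \<in> V. N (\<lambda>x. g x - h x) < e}"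
      unfolding \<U>_def by blast
    ultimately have h: "h \<in> V" "N (\<lambda>x. s j x - h x) < e" "N (\<lambda>x. s k x - h x) < e"
      using w(2)[of j] w(2)[of k] by auto
    have sV: "s j \<in> V" "s k \<in> V" using s QV by auto
    have "N (\<lambda>x. s j x - s k x) \<le> K * (N (\<lambda>x. s j x - h x) + N (\<lambda>x. h x - s k x))"
      using K1 sV h by blast
    also have "N (\<lambda>x. h x - s k x) = N (\<lambda>x. s k x - h x)"
      using quasi_norm_minus_commute[OF V] sV h by blast
    also have "K * (N (\<lambda>x. s j x - h x) + N (\<lambda>x. s k x - h x)) < K * (e + e)"
      using h K1 by (intro mult_strict_left_mono add_strict_mono) auto
    also have "\<dots> = \<delta>" using K1 by (simp add: e_def)
    finally show False using sep[OF jk] by simp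
  qed
  then have "inj w" by (metis injI linorder_neqE_nat)
  moreover have "finite (range w)" using w(1) F(1) by (meson finite_subset image_subsetI)
  ultimately show False using finite_imageD by blast
qed

text \<open>
  Every point has a neighbourhood on which the quasi-norm is bounded, by the quasi-triangle
  inequality, although the quasi-norm may fail to be continuous.
\<close>

lemma compactin_quasi_norm_bounded:
  assumes V: "complex_function_space V" "quasi_norm_on V N"
    and K: "compactin (quasi_norm_topology V N) Q"
  shows "\<exists>C. \<forall>h\<in>Q. N h \<le> C"
proof -
  have top: "topspace (quasi_norm_topology V N) \<subseteq> V"
    using openin_topspace openin_quasi_norm_topology by metis
  then have QV: "Q \<subseteq> V" using K by (auto simp: compactin_def)
  obtain K where K1: "K \<ge> 1"
    "\<And>h k. h \<in> V \<Longrightarrow> k \<in> V \<Longrightarrow> N (\<lambda>x. h x + k x) \<le> K * (N h + N k)"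
    using V(2) unfolding quasi_norm_on_def by blast
  define \<U> where "\<U> = {W. openin (quasi_norm_topology V N) W \<and> (\<exists>C. \<forall>h\<in>W. N h \<le> C)}"
  have "Q \<subseteq> \<Union>\<U>"
  proof
    fix h assume "h \<in> Q"
    then have h: "h \<in> V" using QV by blast
    obtain W where W: "openin (quasi_norm_topology V N) W" "h \<in> W"
      "W \<subseteq> {g \<in> V. N (\<lambda>x. g x - h x) < 1}"
      using quasi_norm_ball_neighbourhood[OF V h] zero_less_one by blast
    have "N g \<le> K * (1 + N h)" if g: "g \<in> W" for g
    proof -
      have gV: "g \<in> V" "N (\<lambda>x. g x - h x) < 1" using g W by auto
      then have "N (\<lambda>x. (g x - h x) + h x) \<le> K * (N (\<lambda>x. g x - h x) + N h)"
        using h complex_function_space_diff[OF V(1)] by (intro K1)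
      also have "\<dots> \<le> K * (1 + N h)" using gV K1(1) by (intro mult_left_mono) auto
      finally show ?thesis by simp
    qed
    then show "h \<in> \<Union>\<U>" using W unfolding \<U>_def by blast
  qed
  moreover have "\<forall>W\<in>\<U>. openin (quasi_norm_topology V N) W" by (simp add: \<U>_def)
  ultimately obtain \<F> where F: "finite \<F>" "\<F> \<subseteq> \<U>" "Q \<subseteq> \<Union>\<F>"
    using K unfolding compactin_def by meson
  have "\<forall>W. \<exists>C. W \<in> \<F> \<longrightarrow> (\<forall>h\<in>W. N h \<le> C)" using F(2) unfolding \<U>_def by blast
  then obtain C where C: "\<And>W h. W \<in> \<F> \<Longrightarrow> h \<in> W \<Longrightarrow> N h \<le> C W" by metis
  have "N h \<le> (\<Sum>W\<in>\<F>. \<bar>C W\<bar>)" if hQ: "h \<in> Q" for h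
  proof -
    obtain W where W: "W \<in> \<F>" "h \<in> W" using hQ F by blast
    have "N h \<le> \<bar>C W\<bar>" using C[OF W] by linarith
    also have "\<dots> \<le> (\<Sum>W\<in>\<F>. \<bar>C W\<bar>)" using F(1) W(1) by (intro member_le_sum) auto
    finally show ?thesis .
  qed
  then show ?thesis by blast
qed

lemma quasi_norm_normalise:
  assumes V: "complex_function_space V" "quasi_norm_on V N" and h: "h \<in> V" "N h > 0"
  shows "(\<lambda>x. of_real (1 / N h) * h x) \<in> V" "N (\<lambda>x. of_real (1 / N h) * h x) = 1"
proof -
  show "(\<lambda>x. of_real (1 / N h) * h x) \<in> V"
    using complex_function_space_scale[OF V(1) h(1)] .
  have "N (\<lambda>x. of_real (1 / N h) * h x) = cmod (of_real (1 / N h)) * N h"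
    using quasi_norm_scale[OF V(2) h(1)] .
  then show "N (\<lambda>x. of_real (1 / N h) * h x) = 1" using h by (simp add: norm_divide)
qed

text \<open>
  The functions that stay below a number smaller than 1 on \<open>K\<close> form a neighbourhood of 0 for compact
  convergence, so they contain a quasi-norm ball of \<open>V\<close>; homogeneity makes this a linear bound.
\<close>

lemma continuous_inclusion_sup_bound:
  assumes V: "complex_function_space V" "quasi_norm_on V N"
    and inc: "continuous_inclusion A V N" and K: "compact K"
  shows "\<exists>C\<ge>0. \<forall>h\<in>V. \<forall>x\<in>K. cmod (h x) \<le> C * N h"
proof -
  define W where "W = {h \<in> hol_funs A. \<exists>d<1. \<forall>x\<in>K. cmod (h x) \<le> d}"
  have "\<exists>K e. compact K \<and> e > 0 \<and> {g \<in> hol_funs A. \<forall>x\<in>K. cmod (g x - h x) < e} \<subseteq> W"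
    if hW: "h \<in> W" for h
  proof -
    obtain d where d: "d < 1" "\<forall>x\<in>K. cmod (h x) \<le> d" using hW by (auto simp: W_def)
    have "g \<in> W" if g: "g \<in> hol_funs A" "\<forall>x\<in>K. cmod (g x - h x) < (1 - d) / 2" for g
    proof -
      have "cmod (g x) \<le> (1 + d) / 2" if x: "x \<in> K" for x
      proof -
        have "cmod (g x) \<le> cmod (g x - h x) + cmod (h x)" by norm
        also have "\<dots> \<le> (1 - d) / 2 + d" using g(2) d(2) x by (intro add_mono) (auto intro: less_imp_le)
        finally show ?thesis by (simp add: field_simps)
      qed
      moreover have "(1 + d) / 2 < 1" using d by simp
      ultimately show ?thesis using g unfolding W_def by blast
    qed
    then show ?thesis using K d by (intro exI[of _ K] exI[of _ "(1 - d) / 2"]) auto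
  qed
  then have "openin (compact_conv_topology A) W"
    by (auto simp: openin_compact_conv_topology W_def)
  define P where "P = {h \<in> topspace (quasi_norm_topology V N). h \<in> W}"
  have P: "openin (quasi_norm_topology V N) P"
    using inc \<open>openin (compact_conv_topology A) W\<close>
    unfolding continuous_inclusion_def continuous_map_def P_def by blast
  have z: "(\<lambda>x. 0) \<in> P"
  proof -
    note z = complex_function_space_zero[OF V(1)]
    have "openin (quasi_norm_topology V N) V"
      unfolding openin_quasi_norm_topology using zero_less_one by blast
    then have "(\<lambda>x. 0) \<in> topspace (quasi_norm_topology V N)"
      using z openin_subset by blast
    moreover have "(\<lambda>x. 0) \<in> W"
      using z inc unfolding W_def continuous_inclusion_def by (auto intro: exI[of _ 0])
    ultimately show ?thesis by (simp add: P_def)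
  qed
  obtain e where e: "e > 0" "{g \<in> V. N (\<lambda>x. g x - 0) < e} \<subseteq> P"
    using P[unfolded openin_quasi_norm_topology, THEN conjunct2, rule_format, OF z] by blast
  have e2: "g \<in> W" if "g \<in> V" "N g < e" for g
    using e(2) that by (auto simp: P_def)
  have "cmod (h x) \<le> (2 / e) * N h" if h: "h \<in> V" "x \<in> K" for h x
  proof (cases "N h = 0")
    case True
    then have "h = (\<lambda>x. 0)" using quasi_norm_eq_0D[OF V(2) h(1)] by simp
    then show ?thesis using True by simp
  next
    case False
    then have pos: "N h > 0" using quasi_norm_pos[OF V(2) h(1)] by simp
    define c where "c = complex_of_real (e / (2 * N h))"
    have cm: "cmod c = e / (2 * N h)" using e pos by (simp add: c_def norm_divide norm_mult)
    have "N (\<lambda>x. c * h x) = cmod c * N h" using quasi_norm_scale[OF V(2) h(1)] .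
    also have "\<dots> < e" using e pos by (simp add: cm field_simps)
    finally have "(\<lambda>x. c * h x) \<in> W"
      using e2[OF complex_function_space_scale[OF V(1) h(1)]] by simp
    then obtain d where "d < 1" "\<forall>x\<in>K. cmod (c * h x) \<le> d" unfolding W_def by auto
    then have "cmod (c * h x) < 1" using h(2) by fastforce
    then show ?thesis using e pos by (simp add: norm_mult cm field_simps)
  qed
  moreover have "2 / e \<ge> 0" using e by simp
  ultimately show ?thesis by blast
qed

section \<open>Operators that act by scalars on a graded space\<close>

text \<open>
  An abstract form of the situation at the fixed point.  The spaces \<open>E n\<close> are a decreasing filtration
  that is respected by \<open>T\<close>.  Each \<open>L n\<close> is a bounded functional on \<open>E n\<close> that descends to
  \<open>E n / E (n + 1)\<close>, and \<open>T\<close> multiplies its values by \<open>\<mu> n\<close>.  Outside \<open>E n\<close> the values of \<open>L n\<close> are arbitrary.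
\<close>

locale graded_eigenfunctionals =
  fixes V :: "('a \<Rightarrow> complex) set" and N :: "('a \<Rightarrow> complex) \<Rightarrow> real"
    and T :: "('a \<Rightarrow> complex) \<Rightarrow> ('a \<Rightarrow> complex)"
    and E :: "nat \<Rightarrow> ('a \<Rightarrow> complex) set"
    and L :: "nat \<Rightarrow> ('a \<Rightarrow> complex) \<Rightarrow> complex"
    and \<mu> :: "nat \<Rightarrow> complex"
  assumes space: "complex_function_space V" and qnorm: "quasi_norm_on V N"
    and E_subset: "E n \<subseteq> V"
    and E_diff: "h \<in> E n \<Longrightarrow> k \<in> E n \<Longrightarrow> (\<lambda>x. h x - k x) \<in> E n"
    and E_scale: "h \<in> E n \<Longrightarrow> (\<lambda>x. c * h x) \<in> E n"
    and E_antimono: "m \<le> n \<Longrightarrow> E n \<subseteq> E m"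
    and T_E: "h \<in> E n \<Longrightarrow> T h \<in> E n"
    and L_diff: "h \<in> E n \<Longrightarrow> k \<in> E n \<Longrightarrow> L n (\<lambda>x. h x - k x) = L n h - L n k"
    and L_scale: "h \<in> E n \<Longrightarrow> L n (\<lambda>x. c * h x) = c * L n h"
    and L_bounded: "\<exists>B. \<forall>h\<in>E n. cmod (L n h) \<le> B * N h"
    and L_higher: "h \<in> E m \<Longrightarrow> n < m \<Longrightarrow> L n h = 0"
    and L_eigen: "h \<in> E n \<Longrightarrow> L n (T h) = \<mu> n * L n h"
begin

text \<open>
  Here \<open>s\<close> is the norm of the functional \<open>L n\<close> on \<open>E n\<close>.  A quasi-norm ball need not contain a
  maximiser, so one is content with half of the supremum.
\<close>

lemma near_maximiser:
  assumes "h\<^sub>0 \<in> E n" "L n h\<^sub>0 \<noteq> 0"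
  obtains s h where "s > 0" "h \<in> E n" "N h \<le> 1" "cmod (L n h) > s / 2"
    "\<And>g. g \<in> E n \<Longrightarrow> cmod (L n g) \<le> s * N g"
proof -
  obtain B where B: "\<And>h. h \<in> E n \<Longrightarrow> cmod (L n h) \<le> B * N h" using L_bounded by blast
  have pos: "N g > 0" if g: "g \<in> E n" "L n g \<noteq> 0" for g
  proof -
    have "N g \<noteq> 0" using B[OF g(1)] g(2) by auto
    then show ?thesis using quasi_norm_pos[OF qnorm] g E_subset by blast
  qed
  define X where "X = (\<lambda>h. cmod (L n h)) ` {h \<in> E n. N h \<le> 1}"
  have normalised: "cmod (L n g) / N g \<in> X" if g: "g \<in> E n" "L n g \<noteq> 0" for g
  proof -
    let ?g = "\<lambda>x. complex_of_real (1 / N g) * g x"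
    have "?g \<in> E n" using E_scale g by blast
    moreover have "N ?g = 1"
      using quasi_norm_normalise[OF space qnorm] g pos E_subset by blast
    moreover have "cmod (L n ?g) = cmod (L n g) / N g"
      using L_scale[OF g(1), of "complex_of_real (1 / N g)"] pos[OF g]
      by (simp add: norm_mult norm_divide)
    ultimately have "?g \<in> {h \<in> E n. N h \<le> 1}" "cmod (L n g) / N g = cmod (L n ?g)"
      by simp_all
    then show ?thesis unfolding X_def by (intro image_eqI[where x = ?g])
  qed
  have bdd: "bdd_above X"
  proof (rule bdd_aboveI[of _ "\<bar>B\<bar>"])
    fix y assume "y \<in> X"
    then obtain h where h: "h \<in> E n" "N h \<le> 1" "y = cmod (L n h)" by (auto simp: X_def)
    have "N h \<ge> 0" using h E_subset quasi_norm_nonneg[OF qnorm] by blast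
    then have "B * N h \<le> \<bar>B\<bar> * 1" using h(2) by (intro mult_mono) auto
    then show "y \<le> \<bar>B\<bar>" using B[OF h(1)] h(3) by simp
  qed
  define s where "s = Sup X"
  have "cmod (L n h\<^sub>0) / N h\<^sub>0 \<le> s"
    using normalised[OF assms] bdd unfolding s_def by (rule cSup_upper)
  moreover have "cmod (L n h\<^sub>0) / N h\<^sub>0 > 0" using assms pos[OF assms] by simp
  ultimately have s: "s > 0" by linarith
  then have "s / 2 < Sup X" by (simp add: s_def)
  then obtain y where "y \<in> X" "s / 2 < y"
    using less_cSup_iff[OF _ bdd] normalised[OF assms] by blast
  then obtain h where h: "h \<in> E n" "N h \<le> 1" "s / 2 < cmod (L n h)" by (auto simp: X_def)
  have "cmod (L n g) \<le> s * N g" if g: "g \<in> E n" for g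
  proof (cases "L n g = 0")
    case True
    have "N g \<ge> 0" using g E_subset quasi_norm_nonneg[OF qnorm] by blast
    then show ?thesis using True s by simp
  next
    case False
    have "cmod (L n g) / N g \<le> s"
      using normalised[OF g False] bdd unfolding s_def by (rule cSup_upper)
    then show ?thesis using pos[OF g False] by (simp add: field_simps)
  qed
  then show thesis using that s h by blast
qed

text \<open>
  Comparing \<open>L n (T h)\<close> with \<open>\<mu> n * L n h\<close> for an \<open>h\<close> that almost realises the norm of \<open>L n\<close> cancels this
  norm, so the bound does not depend on \<open>n\<close>.  The factor 2 comes from the near maximiser.
\<close>

lemma bounded_imp_eigenvalue_bound:
  assumes C: "C \<ge> 0" "\<And>h. h \<in> V \<Longrightarrow> N (T h) \<le> C * N h" and ne: "h\<^sub>0 \<in> E n" "L n h\<^sub>0 \<noteq> 0"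
  shows "cmod (\<mu> n) \<le> 2 * C"
proof -
  obtain s h where sh: "s > 0" "h \<in> E n" "N h \<le> 1" "cmod (L n h) > s / 2"
    "\<And>g. g \<in> E n \<Longrightarrow> cmod (L n g) \<le> s * N g"
    using near_maximiser[OF ne] by blast
  have "cmod (\<mu> n) * (s / 2) \<le> cmod (\<mu> n) * cmod (L n h)"
    using sh by (intro mult_left_mono) auto
  also have "\<dots> = cmod (L n (T h))" using L_eigen[OF sh(2)] by (simp add: norm_mult)
  also have "\<dots> \<le> s * N (T h)" using sh T_E by blast
  also have "N (T h) \<le> C * N h" using sh E_subset by (intro C) blast
  also have "C * N h \<le> C * 1" using sh C by (intro mult_left_mono) auto
  finally show ?thesis using sh by (simp add: field_simps)
qed

text \<open>
  Take \<open>h\<^sub>n \<in> E n\<close> in the unit ball that almost realise the norm of \<open>L n\<close>.  For \<open>m > n\<close> the functional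
  \<open>L n\<close> does not see \<open>T h\<^sub>m\<close>, so it keeps \<open>T h\<^sub>n\<close> and \<open>T h\<^sub>m\<close> at least
  \<open>|\<mu> n| / 2\<close> apart.
\<close>

lemma compact_imp_finitely_many_large_eigenvalues:
  assumes compact: "\<And>x \<delta>. (\<And>j::nat. x j \<in> V \<and> N (x j) \<le> 1) \<Longrightarrow> \<delta> > 0 \<Longrightarrow>
      \<exists>j k. j < k \<and> N (\<lambda>z. T (x j) z - T (x k) z) < \<delta>"
    and c: "c > 0"
  shows "finite {n. (\<exists>h\<in>E n. L n h \<noteq> 0) \<and> cmod (\<mu> n) \<ge> c}" (is "finite ?I")
proof (rule ccontr)
  assume inf: "infinite ?I"
  define i where "i = enumerate ?I"
  have i: "strict_mono i" "i j \<in> ?I" for j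
    unfolding i_def using strict_mono_enumerate[OF inf] enumerate_in_set[OF inf] by auto
  have "\<exists>h s. s > 0 \<and> h \<in> E (i j) \<and> N h \<le> 1 \<and> cmod (L (i j) h) > s / 2 \<and>
    (\<forall>g\<in>E (i j). cmod (L (i j) g) \<le> s * N g)" for j
  proof -
    obtain h\<^sub>0 where "h\<^sub>0 \<in> E (i j)" "L (i j) h\<^sub>0 \<noteq> 0" using i(2)[of j] by blast
    then show ?thesis by (meson near_maximiser)
  qed
  then obtain x s where x: "\<And>j. s j > 0" "\<And>j. x j \<in> E (i j)" "\<And>j. N (x j) \<le> 1"
    "\<And>j. cmod (L (i j) (x j)) > s j / 2"
    "\<And>j g. g \<in> E (i j) \<Longrightarrow> cmod (L (i j) g) \<le> s j * N g"
    by metis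
  have "c / 2 > 0" using c by simp
  moreover have "x j \<in> V \<and> N (x j) \<le> 1" for j using x(2,3) E_subset by blast
  ultimately obtain j k where jk: "j < k" "N (\<lambda>z. T (x j) z - T (x k) z) < c / 2"
    using compact[of x "c / 2"] by auto
  have ij: "i j < i k" using i(1) jk(1) by (simp add: strict_mono_def)
  have k1: "T (x k) \<in> E (i k)" using T_E x(2) by blast
  then have k2: "T (x k) \<in> E (i j)" using E_antimono[of "i j" "i k"] ij by auto
  have j1: "T (x j) \<in> E (i j)" using T_E x(2) by blast
  have "c * (s j / 2) \<le> cmod (\<mu> (i j)) * cmod (L (i j) (x j))"
    using i(2)[of j] c x(1,4)[of j] by (intro mult_mono) auto
  also have "\<dots> = cmod (L (i j) (\<lambda>z. T (x j) z - T (x k) z))"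
    using L_diff[OF j1 k2] L_higher[OF k1 ij] L_eigen[OF x(2)] by (simp add: norm_mult)
  also have "\<dots> \<le> s j * N (\<lambda>z. T (x j) z - T (x k) z)" using x(5) E_diff[OF j1 k2] by blast
  also have "\<dots> < s j * (c / 2)" using jk x(1) by (intro mult_strict_left_mono)
  finally show False by simp
qed

end

section \<open>Holomorphic functions along complex lines\<close>

lemma norm_vector_scale: "norm (c *s v) = cmod c * norm (v :: complex ^ 'n)"
  by (simp add: norm_vec_def L2_set_def norm_mult power_mult_distrib real_sqrt_mult
      flip: sum_distrib_left)

lemma isCont_filterlim_nhds: "isCont f x \<Longrightarrow> filterlim f (nhds (f x)) (nhds x)"
  unfolding isCont_def tendsto_at_iff_tendsto_nhds .

lemma bounded_linear_scale_vector: "bounded_linear (\<lambda>t. t *s (v :: complex ^ 'n))"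
  by (rule bounded_linear_intro[where K = "norm v"])
     (simp_all add: vec_eq_iff algebra_simps norm_vector_scale)

lemma complex_line_has_derivative:
  "((\<lambda>s. a + s *s (b :: complex ^ 'n)) has_derivative (\<lambda>t. t *s b)) F"
  by (auto intro!: derivative_eq_intros bounded_linear_imp_has_derivative
      bounded_linear_scale_vector)

lemma holomorphic_several_on_line:
  assumes "holomorphic_several g S"
  shows "(\<lambda>s. g (a + s *s b)) holomorphic_on {s. a + s *s b \<in> S}"
  unfolding holomorphic_on_def
proof
  fix s assume "s \<in> {s. a + s *s b \<in> S}"
  then obtain D where D: "(g has_derivative D) (at (a + s *s b))" "\<And>c v. D (c *s v) = c * D v"
    using assms unfolding holomorphic_several_def by blast
  have "((\<lambda>s. g (a + s *s b)) has_derivative (\<lambda>t. D (t *s b))) (at s)"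
    using has_derivative_compose[OF complex_line_has_derivative D(1)] .
  moreover have "(\<lambda>t. D (t *s b)) = (*) (D b)" by (simp add: D(2) fun_eq_iff mult.commute)
  ultimately have "((\<lambda>s. g (a + s *s b)) has_field_derivative D b) (at s)"
    by (simp add: has_field_derivative_def)
  then show "(\<lambda>s. g (a + s *s b)) field_differentiable at s within {s. a + s *s b \<in> S}"
    using field_differentiable_at_within field_differentiable_def by blast
qed

text \<open>
  Cauchy's estimate on discs of radius \<open>R / 2\<close> around the points of the unit disc bounds the
  derivative by \<open>2 B / R\<close>; these discs stay inside because \<open>R \<ge> 4\<close>.
\<close>

lemma bounded_holomorphic_increment:
  assumes hol: "f holomorphic_on ball 0 R" and R: "R \<ge> 4"
    and B: "\<And>z. z \<in> ball 0 R \<Longrightarrow> cmod (f z) \<le> B"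
  shows "cmod (f 1 - f 0) \<le> 2 * B / R"
proof -
  have "cmod (deriv f z) \<le> 2 * B / R" if z: "z \<in> cball 0 1" for z
  proof -
    have sub: "cball z (R / 2) \<subseteq> ball 0 R"
    proof
      fix w assume "w \<in> cball z (R / 2)"
      then have "cmod (w - z) \<le> R / 2" by (simp add: dist_norm norm_minus_commute)
      moreover have "cmod w \<le> cmod (w - z) + cmod z" by norm
      ultimately show "w \<in> ball 0 R" using z R by simp
    qed
    have "cmod ((deriv ^^ 1) f z) \<le> fact 1 * B / (R / 2) ^ 1"
    proof (rule Cauchy_inequality)
      show "f holomorphic_on ball z (R / 2)"
        using hol sub ball_subset_cball by (meson holomorphic_on_subset subset_trans)
      show "continuous_on (cball z (R / 2)) f"
        using hol sub holomorphic_on_imp_continuous_on holomorphic_on_subset by blast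
      show "cmod (f x) \<le> B" if "cmod (z - x) = R / 2" for x
        using that sub by (intro B) (auto simp: dist_norm)
    qed (use R in auto)
    then show ?thesis by (simp add: mult.commute)
  qed
  moreover have "(f has_field_derivative deriv f z) (at z within cball 0 1)" if "z \<in> cball 0 1" for z
    using that R by (intro holomorphic_derivI[OF hol]) auto
  ultimately have "cmod (f 1 - f 0) \<le> (2 * B / R) * cmod (1 - 0)"
    by (intro field_differentiable_bound[of "cball 0 1" f "deriv f"]) auto
  then show ?thesis by simp
qed

text \<open>
  If \<open>H = O(|z - a|\<^sup>n)\<close>, Cauchy's estimate on complex discs of radius comparable to \<open>|t|\<close> bounds
  the derivative of \<open>H\<close> at distance \<open>O(|t|)\<close> from \<open>a\<close> by \<open>O(|t|\<^sup>n\<^sup>-\<^sup>1)\<close>.  Moving the argument by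
  \<open>o(t)\<close> therefore changes \<open>H\<close> by \<open>o(t\<^sup>n)\<close> only.
\<close>

lemma increment_of_higher_order:
  fixes c1 c2 :: "complex \<Rightarrow> complex ^ 'n"
  assumes H: "holomorphic_several H Z" and \<rho>: "\<rho> > 0" "ball a \<rho> \<subseteq> Z"
    and C: "C \<ge> 0" "\<And>z. z \<in> ball a \<rho> \<Longrightarrow> cmod (H z) \<le> C * norm (z - a) ^ n"
    and c1: "\<And>t. norm (c1 t - a) \<le> \<beta> * cmod t" "\<beta> \<ge> 0"
    and c2: "((\<lambda>t. norm (c2 t - c1 t) / cmod t) \<longlongrightarrow> 0) (at 0)"
  shows "((\<lambda>t. (H (c2 t) - H (c1 t)) / t ^ n) \<longlongrightarrow> 0) (at 0)"
proof (rule Lim_null_comparison)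
  show "((\<lambda>t. 2 * C * (\<beta> + 1) ^ n * (norm (c2 t - c1 t) / cmod t)) \<longlongrightarrow> 0) (at 0)"
    by (rule tendsto_mult_right_zero[OF c2])
  have "\<forall>\<^sub>F t in at 0. norm (c2 t - c1 t) / cmod t < 1 / 4"
    by (rule order_tendstoD(2)[OF c2]) simp
  moreover have "\<forall>\<^sub>F t in at (0::complex). cmod t < \<rho> / (\<beta> + 1)"
    unfolding eventually_at using \<rho> c1 by (intro exI[of _ "\<rho> / (\<beta> + 1)"]) auto
  moreover have "\<forall>\<^sub>F t in at (0::complex). t \<noteq> 0"
    by (simp add: eventually_at_filter)
  ultimately show "\<forall>\<^sub>F t in at 0. cmod ((H (c2 t) - H (c1 t)) / t ^ n)
      \<le> 2 * C * (\<beta> + 1) ^ n * (norm (c2 t - c1 t) / cmod t)"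
  proof eventually_elim
    case (elim t)
    define d where "d = c2 t - c1 t"
    show ?case
    proof (cases "d = 0")
      case True
      then show ?thesis by (simp add: d_def)
    next
      case False
      \<comment> \<open>On the disc of radius \<open>R\<close> in the direction \<open>d\<close> the argument moves by at most \<open>|t|\<close>.\<close>
      define R where "R = cmod t / norm d"
      define B where "B = C * ((\<beta> + 1) * cmod t) ^ n"
      have R: "R \<ge> 4" using elim False by (simp add: R_def d_def field_simps)
      have near: "norm (c1 t + s *s d - a) \<le> (\<beta> + 1) * cmod t" if s: "s \<in> ball 0 R" for s
      proof -
        have "cmod s * norm d \<le> cmod t" using s False by (simp add: R_def field_simps)
        then have "norm (c1 t - a) + norm (s *s d) \<le> \<beta> * cmod t + cmod t"
          using c1(1)[of t] by (simp add: norm_vector_scale)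
        moreover have "norm (c1 t + s *s d - a) \<le> norm (c1 t - a) + norm (s *s d)" by norm
        ultimately show ?thesis by (simp add: algebra_simps)
      qed
      have small: "(\<beta> + 1) * cmod t < \<rho>" using elim c1(2) by (simp add: field_simps)
      have inside: "c1 t + s *s d \<in> ball a \<rho>" if "s \<in> ball 0 R" for s
        using near[OF that] small by (simp add: dist_norm norm_minus_commute)
      have "cmod (H (c1 t + 1 *s d) - H (c1 t + 0 *s d)) \<le> 2 * B / R"
      proof (rule bounded_holomorphic_increment[OF _ R])
        show "(\<lambda>s. H (c1 t + s *s d)) holomorphic_on ball 0 R"
          using inside \<rho>(2)
          by (intro holomorphic_on_subset[OF holomorphic_several_on_line[OF H]]) auto
        show "cmod (H (c1 t + s *s d)) \<le> B" if s: "s \<in> ball 0 R" for s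
        proof -
          have "cmod (H (c1 t + s *s d)) \<le> C * norm (c1 t + s *s d - a) ^ n"
            using inside[OF s] by (rule C)
          also have "\<dots> \<le> B" unfolding B_def
            using near[OF s] C(1) by (intro mult_left_mono power_mono) auto
          finally show ?thesis .
        qed
      qed
      then have "cmod (H (c2 t) - H (c1 t)) \<le> 2 * B / R" by (simp add: d_def)
      then have "cmod (H (c2 t) - H (c1 t)) / cmod t ^ n \<le> (2 * B / R) / cmod t ^ n"
        by (intro divide_right_mono) auto
      also have "\<dots> = 2 * C * (\<beta> + 1) ^ n * (norm d / cmod t)"
        using elim False by (simp add: B_def R_def power_mult_distrib)
      finally show ?thesis by (simp add: d_def norm_divide norm_power)
    qed
  qed
qed

text \<open>
  The quotient \<open>F t / t\<^sup>n\<close> is bounded near 0, so its singularity is removable.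
\<close>

lemma leading_coefficient:
  assumes F: "F holomorphic_on ball 0 R" and \<rho>: "0 < \<rho>" "\<rho> < R"
    and O: "\<forall>\<^sub>F t in at 0. cmod (F t) \<le> C * cmod t ^ n"
  shows "\<exists>l. ((\<lambda>t. F t / t ^ n) \<longlongrightarrow> l) (at 0) \<and>
    (\<forall>M. (\<forall>t. cmod t = \<rho> \<longrightarrow> cmod (F t) \<le> M) \<longrightarrow> cmod l \<le> M / \<rho> ^ n)"
proof -
  have hol: "(\<lambda>t. F t / t ^ n) holomorphic_on ball 0 R - {0}"
    by (intro holomorphic_intros holomorphic_on_subset[OF F]) auto
  have bounded: "\<forall>\<^sub>F t in at 0. cmod (F t / t ^ n) \<le> C"
  proof -
    have "\<forall>\<^sub>F t in at (0::complex). t \<noteq> 0" by (simp add: eventually_at_filter)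
    with O show ?thesis by eventually_elim (simp add: norm_divide norm_power field_simps)
  qed
  have "0 \<in> interior (ball (0::complex) R)" using \<rho> by simp
  from holomorphic_on_extend_bounded[OF hol this] bounded
  obtain g where g: "g holomorphic_on ball 0 R"
    "\<And>t. t \<in> ball 0 R - {0} \<Longrightarrow> g t = F t / t ^ n"
    by blast
  have "isCont g 0"
    using continuous_on_interior[OF holomorphic_on_imp_continuous_on[OF g(1)]] \<rho> by simp
  then have "(g \<longlongrightarrow> g 0) (at 0)" by (simp add: isCont_def)
  moreover have "\<forall>\<^sub>F t in at 0. g t = F t / t ^ n"
    unfolding eventually_at using \<rho> g(2) by (intro exI[of _ R]) auto
  ultimately have lim: "((\<lambda>t. F t / t ^ n) \<longlongrightarrow> g 0) (at 0)"
    by (rule Lim_transform_eventually)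
  have "cmod (g 0) \<le> M / \<rho> ^ n" if M: "\<forall>t. cmod t = \<rho> \<longrightarrow> cmod (F t) \<le> M" for M
  proof -
    have sub: "cball 0 \<rho> \<subseteq> ball (0::complex) R" using \<rho> by auto
    have "cmod ((deriv ^^ 0) g 0) \<le> fact 0 * (M / \<rho> ^ n) / \<rho> ^ 0"
    proof (rule Cauchy_inequality)
      show "g holomorphic_on ball 0 \<rho>"
        using g(1) sub ball_subset_cball by (meson holomorphic_on_subset subset_trans)
      show "continuous_on (cball 0 \<rho>) g"
        using g(1) sub holomorphic_on_imp_continuous_on holomorphic_on_subset by blast
      show "cmod (g x) \<le> M / \<rho> ^ n" if x: "cmod (0 - x) = \<rho>" for x
      proof -
        have "cmod x = \<rho>" "x \<in> ball 0 R - {0}" using x \<rho> by auto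
        then show ?thesis using g(2)[of x] M \<rho>
          by (simp add: norm_divide norm_power divide_right_mono)
      qed
    qed (use \<rho> in auto)
    then show ?thesis by simp
  qed
  then show ?thesis using lim by blast
qed

section \<open>Order of vanishing in a chart\<close>

locale chart_at =
  fixes A :: "('a::t2_space, 'n::finite) atlas" and U :: "'a set"
    and \<phi> :: "'a \<Rightarrow> complex ^ 'n" and p :: 'a
  assumes manifold: "complex_manifold A" and chart: "(U, \<phi>) \<in> A" and p_in: "p \<in> U"
begin

abbreviation \<psi> :: "complex ^ 'n \<Rightarrow> 'a" where "\<psi> \<equiv> inv_into U \<phi>"

lemma open_U: "open U" and open_image: "open (\<phi> ` U)"
  and homeo: "homeomorphism U (\<phi> ` U) \<phi> \<psi>"
  using manifold chart unfolding complex_manifold_def by blast+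

lemma \<psi>_\<phi> [simp]: "x \<in> U \<Longrightarrow> \<psi> (\<phi> x) = x"
  using homeo by (auto simp: homeomorphism_def)

lemma \<phi>_\<psi>: "z \<in> \<phi> ` U \<Longrightarrow> \<phi> (\<psi> z) = z"
  by (simp add: f_inv_into_f)

lemma isCont_\<phi>: "x \<in> U \<Longrightarrow> isCont \<phi> x"
  using homeo open_U by (auto simp: homeomorphism_def continuous_on_eq_continuous_at)

lemma isCont_\<psi>: "z \<in> \<phi> ` U \<Longrightarrow> isCont \<psi> z"
  using homeo open_image by (auto simp: homeomorphism_def continuous_on_eq_continuous_at)

lemma eventually_in_U: "\<forall>\<^sub>F x in nhds p. x \<in> U"
  using eventually_nhds_in_open[OF open_U p_in] .

lemma eventually_in_image: "\<forall>\<^sub>F z in nhds (\<phi> p). z \<in> \<phi> ` U"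
  using eventually_nhds_in_open[OF open_image] p_in by blast

lemma filterlim_\<phi>: "filterlim \<phi> (nhds (\<phi> p)) (nhds p)"
  using isCont_filterlim_nhds[OF isCont_\<phi>[OF p_in]] .

lemma filterlim_\<psi>: "filterlim \<psi> (nhds p) (nhds (\<phi> p))"
  using isCont_filterlim_nhds[OF isCont_\<psi>[of "\<phi> p"]] p_in by simp

lemma hol_funs_in_chart: "h \<in> hol_funs A \<Longrightarrow> holomorphic_several (\<lambda>z. h (\<psi> z)) (\<phi> ` U)"
  using chart by (auto simp: hol_funs_def holomorphic_fun_on_def)

lemma holomorphic_fun_in_chart:
  assumes "open W" "p \<in> W" "holomorphic_fun_on A W h"
  obtains D where "((\<lambda>z. h (\<psi> z)) has_derivative D) (at (\<phi> p))"
  using assms chart p_in unfolding holomorphic_fun_on_def holomorphic_several_def by blast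

lemma holomorphic_fun_isCont:
  assumes "open W" "p \<in> W" "holomorphic_fun_on A W h"
  shows "isCont h p"
proof -
  obtain D where "((\<lambda>z. h (\<psi> z)) has_derivative D) (at (\<phi> p))"
    using holomorphic_fun_in_chart[OF assms] by blast
  then have "isCont (\<lambda>z. h (\<psi> z)) (\<phi> p)" by (rule has_derivative_continuous)
  then have "filterlim (\<lambda>z. h (\<psi> z)) (nhds (h p)) (nhds (\<phi> p))"
    using isCont_filterlim_nhds p_in by fastforce
  from filterlim_compose[OF this filterlim_\<phi>]
  have lim: "filterlim (\<lambda>x. h (\<psi> (\<phi> x))) (nhds (h p)) (nhds p)" .
  have "\<forall>\<^sub>F x in nhds p. h (\<psi> (\<phi> x)) = h x"
    using eventually_in_U by eventually_elim simp
  from filterlim_cong[OF refl refl this] lim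
  show ?thesis unfolding isCont_def tendsto_at_iff_tendsto_nhds by simp
qed

text \<open>
  Membership of a germ in the \<open>n\<close>-th power of the maximal ideal, read as a growth condition.  It is
  meaningful for arbitrary functions, is visibly preserved by composition with a Lipschitz map that
  fixes \<open>p\<close>, and is the form in which Cauchy's estimates take it.
\<close>

definition vanishes_to_order :: "nat \<Rightarrow> ('a \<Rightarrow> complex) \<Rightarrow> bool" where
  "vanishes_to_order n h \<longleftrightarrow> (\<exists>C. \<forall>\<^sub>F x in nhds p. cmod (h x) \<le> C * norm (\<phi> x - \<phi> p) ^ n)"

lemma vanishes_to_orderE:
  assumes "vanishes_to_order n h"
  obtains C where "C \<ge> 0" "\<forall>\<^sub>F x in nhds p. cmod (h x) \<le> C * norm (\<phi> x - \<phi> p) ^ n"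
proof -
  obtain C where C: "\<forall>\<^sub>F x in nhds p. cmod (h x) \<le> C * norm (\<phi> x - \<phi> p) ^ n"
    using assms unfolding vanishes_to_order_def by blast
  have "\<forall>\<^sub>F x in nhds p. cmod (h x) \<le> \<bar>C\<bar> * norm (\<phi> x - \<phi> p) ^ n"
    using C by eventually_elim (meson abs_ge_self mult_right_mono norm_ge_zero order_trans zero_le_power)
  then show thesis by (intro that[of "\<bar>C\<bar>"]) auto
qed

lemma vanishes_to_order_cong:
  assumes "\<forall>\<^sub>F x in nhds p. g x = h x"
  shows "vanishes_to_order n g \<longleftrightarrow> vanishes_to_order n h"
  unfolding vanishes_to_order_def
  by (intro ex_cong1 eventually_cong[OF assms]) auto

lemma vanishes_to_order_add:
  assumes "vanishes_to_order n g" "vanishes_to_order n h"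
  shows "vanishes_to_order n (\<lambda>x. g x + h x)"
proof -
  obtain B C where "\<forall>\<^sub>F x in nhds p. cmod (g x) \<le> B * norm (\<phi> x - \<phi> p) ^ n"
    "\<forall>\<^sub>F x in nhds p. cmod (h x) \<le> C * norm (\<phi> x - \<phi> p) ^ n"
    using assms unfolding vanishes_to_order_def by blast
  then have "\<forall>\<^sub>F x in nhds p. cmod (g x + h x) \<le> (B + C) * norm (\<phi> x - \<phi> p) ^ n"
    by eventually_elim (auto simp: algebra_simps intro: norm_triangle_mono)
  then show ?thesis unfolding vanishes_to_order_def by blast
qed

lemma vanishes_to_order_mult:
  assumes "vanishes_to_order m g" "vanishes_to_order n h"
  shows "vanishes_to_order (m + n) (\<lambda>x. g x * h x)"
proof -
  obtain B where B: "B \<ge> 0" "\<forall>\<^sub>F x in nhds p. cmod (g x) \<le> B * norm (\<phi> x - \<phi> p) ^ m"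
    using assms(1) by (rule vanishes_to_orderE)
  obtain C where C: "\<forall>\<^sub>F x in nhds p. cmod (h x) \<le> C * norm (\<phi> x - \<phi> p) ^ n"
    using assms(2) by (rule vanishes_to_orderE)
  from B(2) C have "\<forall>\<^sub>F x in nhds p. cmod (g x * h x) \<le> (B * C) * norm (\<phi> x - \<phi> p) ^ (m + n)"
  proof eventually_elim
    case (elim x)
    have "cmod (g x * h x) \<le> (B * norm (\<phi> x - \<phi> p) ^ m) * (C * norm (\<phi> x - \<phi> p) ^ n)"
      unfolding norm_mult using elim B(1) by (intro mult_mono) auto
    then show ?case by (simp add: power_add mult_ac)
  qed
  then show ?thesis unfolding vanishes_to_order_def by blast
qed

lemma isCont_vanishes_to_order_0:
  assumes "isCont h p"
  shows "vanishes_to_order 0 h"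
proof -
  have "filterlim h (nhds (h p)) (nhds p)"
    using isCont_filterlim_nhds[OF assms] .
  then have "\<forall>\<^sub>F x in nhds p. dist (h x) (h p) < 1"
    by (rule tendstoD) simp
  then have "\<forall>\<^sub>F x in nhds p. cmod (h x) \<le> (cmod (h p) + 1) * norm (\<phi> x - \<phi> p) ^ 0"
    by eventually_elim (simp add: dist_norm, norm)
  then show ?thesis unfolding vanishes_to_order_def by blast
qed

lemma vanishes_to_order_antimono:
  assumes "vanishes_to_order n h" "m \<le> n"
  shows "vanishes_to_order m h"
proof -
  obtain C where C: "C \<ge> 0" and h: "\<forall>\<^sub>F x in nhds p. cmod (h x) \<le> C * norm (\<phi> x - \<phi> p) ^ n"
    using assms(1) by (rule vanishes_to_orderE)
  have "\<forall>\<^sub>F x in nhds p. dist (\<phi> x) (\<phi> p) < 1"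
    by (rule tendstoD[OF filterlim_\<phi>]) simp
  with h have "\<forall>\<^sub>F x in nhds p. cmod (h x) \<le> C * norm (\<phi> x - \<phi> p) ^ m"
  proof eventually_elim
    case (elim x)
    have "norm (\<phi> x - \<phi> p) ^ n \<le> norm (\<phi> x - \<phi> p) ^ m"
      using elim assms(2) by (intro power_decreasing) (auto simp: dist_norm)
    then show ?case using elim C by (meson mult_left_mono order_trans)
  qed
  then show ?thesis unfolding vanishes_to_order_def by blast
qed

lemma vanishes_to_order_scale:
  assumes "vanishes_to_order n h"
  shows "vanishes_to_order n (\<lambda>x. c * h x)"
  using vanishes_to_order_mult[OF isCont_vanishes_to_order_0 assms, of "\<lambda>_. c"] by simp

lemma vanishes_to_order_diff:
  assumes "vanishes_to_order n g" "vanishes_to_order n h"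
  shows "vanishes_to_order n (\<lambda>x. g x - h x)"
  using vanishes_to_order_add[OF assms(1) vanishes_to_order_scale[OF assms(2), of "-1"]] by simp

lemma differentiable_vanishes_to_order_1:
  assumes D: "((\<lambda>z. h (\<psi> z)) has_derivative D) (at (\<phi> p))" and h: "h p = 0"
  shows "vanishes_to_order 1 h"
proof -
  have bl: "bounded_linear D" using D by (rule has_derivative_bounded_linear)
  obtain B where B: "\<And>z. norm (D z) \<le> norm z * B"
    using bounded_linear.bounded[OF bl] by blast
  obtain d where d: "d > 0" "\<And>z. norm (z - \<phi> p) < d \<Longrightarrow>
      norm (h (\<psi> z) - h (\<psi> (\<phi> p)) - D (z - \<phi> p)) \<le> 1 * norm (z - \<phi> p)"
    using D unfolding has_derivative_at_alt by (meson zero_less_one)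
  have bound: "cmod (h (\<psi> z)) \<le> (B + 1) * norm (z - \<phi> p)" if "norm (z - \<phi> p) < d" for z
  proof -
    have "norm (h (\<psi> z) - D (z - \<phi> p)) \<le> norm (z - \<phi> p)" using d(2)[OF that] h p_in by simp
    moreover have "cmod (h (\<psi> z)) \<le> norm (h (\<psi> z) - D (z - \<phi> p)) + norm (D (z - \<phi> p))" by norm
    ultimately show ?thesis using B[of "z - \<phi> p"] by (simp add: algebra_simps)
  qed
  have "\<forall>\<^sub>F x in nhds p. dist (\<phi> x) (\<phi> p) < d"
    by (rule tendstoD[OF filterlim_\<phi> d(1)])
  with eventually_in_U have "\<forall>\<^sub>F x in nhds p. cmod (h x) \<le> (B + 1) * norm (\<phi> x - \<phi> p) ^ 1"
  proof eventually_elim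
    case (elim x)
    then show ?case using bound[of "\<phi> x"] by (simp add: dist_norm)
  qed
  then show ?thesis unfolding vanishes_to_order_def by blast
qed

lemma vanishes_to_order_in_chart:
  assumes "vanishes_to_order n h"
  obtains C \<rho> where "C \<ge> 0" "\<rho> > 0" "ball (\<phi> p) \<rho> \<subseteq> \<phi> ` U"
    "\<And>z. z \<in> ball (\<phi> p) \<rho> \<Longrightarrow> cmod (h (\<psi> z)) \<le> C * norm (z - \<phi> p) ^ n"
proof -
  obtain C where C: "C \<ge> 0" "\<forall>\<^sub>F x in nhds p. cmod (h x) \<le> C * norm (\<phi> x - \<phi> p) ^ n"
    using assms by (rule vanishes_to_orderE)
  have "\<forall>\<^sub>F z in nhds (\<phi> p). cmod (h (\<psi> z)) \<le> C * norm (\<phi> (\<psi> z) - \<phi> p) ^ n"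
    using filterlim_\<psi> C(2) unfolding filterlim_iff by blast
  with eventually_in_image
  have "\<forall>\<^sub>F z in nhds (\<phi> p). z \<in> \<phi> ` U \<and> cmod (h (\<psi> z)) \<le> C * norm (z - \<phi> p) ^ n"
    by eventually_elim (simp add: \<phi>_\<psi>)
  then obtain \<rho> where "\<rho> > 0"
    "\<forall>z. dist z (\<phi> p) < \<rho> \<longrightarrow> z \<in> \<phi> ` U \<and> cmod (h (\<psi> z)) \<le> C * norm (z - \<phi> p) ^ n"
    unfolding eventually_nhds_metric by blast
  then show thesis using C(1) by (intro that[of C \<rho>]) (auto simp: dist_commute)
qed

section \<open>Leading coefficients along a complex line\<close>

definition line :: "complex ^ 'n \<Rightarrow> complex \<Rightarrow> 'a" where
  "line v t = \<psi> (\<phi> p + t *s v)"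

lemma line_tendsto: "(line v \<longlongrightarrow> p) (at 0)"
proof -
  have "isCont (\<lambda>t. \<phi> p + t *s v) 0"
    using complex_line_has_derivative has_derivative_continuous by blast
  then have "filterlim (\<lambda>t. \<phi> p + t *s v) (nhds (\<phi> p)) (at 0)" by (simp add: isCont_def)
  from filterlim_compose[OF filterlim_\<psi> this] show ?thesis by (simp add: line_def[abs_def])
qed

lemma line_in_chart:
  obtains R where "R > 0" "\<And>t. t \<in> ball 0 R \<Longrightarrow> \<phi> p + t *s v \<in> \<phi> ` U"
proof -
  have "isCont (\<lambda>t. \<phi> p + t *s v) 0"
    using complex_line_has_derivative has_derivative_continuous by blast
  then have "filterlim (\<lambda>t. \<phi> p + t *s v) (nhds (\<phi> p)) (nhds 0)"
    using isCont_filterlim_nhds by fastforce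
  then have "\<forall>\<^sub>F t in nhds 0. \<phi> p + t *s v \<in> \<phi> ` U"
    using eventually_in_image unfolding filterlim_iff by blast
  then obtain R where "R > 0" "\<forall>t. dist t 0 < R \<longrightarrow> \<phi> p + t *s v \<in> \<phi> ` U"
    unfolding eventually_nhds_metric by blast
  then show thesis by (intro that[of R]) auto
qed

lemma vanishes_to_order_on_line:
  assumes "vanishes_to_order n h"
  shows "\<exists>C. \<forall>\<^sub>F t in at 0. cmod (h (line v t)) \<le> C * cmod t ^ n"
proof -
  obtain C where C: "\<forall>\<^sub>F x in nhds p. cmod (h x) \<le> C * norm (\<phi> x - \<phi> p) ^ n"
    using assms unfolding vanishes_to_order_def by blast
  then have "\<forall>\<^sub>F t in at 0. cmod (h (line v t)) \<le> C * norm (\<phi> (line v t) - \<phi> p) ^ n"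
    using line_tendsto unfolding filterlim_iff by blast
  moreover obtain R where R: "R > 0" "\<And>t. t \<in> ball 0 R \<Longrightarrow> \<phi> p + t *s v \<in> \<phi> ` U"
    using line_in_chart[of v] by blast
  have "\<forall>\<^sub>F t in at 0. \<phi> p + t *s v \<in> \<phi> ` U"
    unfolding eventually_at using R by (intro exI[of _ R]) auto
  ultimately have "\<forall>\<^sub>F t in at 0. cmod (h (line v t)) \<le> (C * norm v ^ n) * cmod t ^ n"
    by eventually_elim (simp add: line_def \<phi>_\<psi> norm_vector_scale power_mult_distrib mult_ac)
  then show ?thesis by blast
qed

text \<open>
  For a holomorphic function whose Taylor expansion at \<open>p\<close> begins in degree \<open>n\<close> or later this is the
  value at \<open>v\<close> of the homogeneous part of degree \<open>n\<close>.
\<close>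

definition leading :: "complex ^ 'n \<Rightarrow> nat \<Rightarrow> ('a \<Rightarrow> complex) \<Rightarrow> complex" where
  "leading v n h = Lim (at 0) (\<lambda>t. h (line v t) / t ^ n)"

lemma leading_eqI: "((\<lambda>t. h (line v t) / t ^ n) \<longlongrightarrow> l) (at 0) \<Longrightarrow> leading v n h = l"
  unfolding leading_def by (simp add: tendsto_Lim)

text \<open>
  By Riemann's theorem \<open>h(line v t) / t\<^sup>n\<close> extends holomorphically over 0, and its value there is
  bounded by its maximum on a circle.  The compact set is the image of that circle; it depends on
  the direction only, neither on \<open>h\<close> nor on \<open>n\<close>, so that point evaluations on it bound all these
  coefficients.
\<close>

lemma leading_Cauchy_bound:
  "\<exists>K \<rho>. compact K \<and> \<rho> > 0 \<and> (\<forall>h\<in>hol_funs A. \<forall>n. vanishes_to_order n h \<longrightarrow>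
     ((\<lambda>t. h (line v t) / t ^ n) \<longlongrightarrow> leading v n h) (at 0) \<and>
     (\<forall>M. (\<forall>x\<in>K. cmod (h x) \<le> M) \<longrightarrow> cmod (leading v n h) \<le> M / \<rho> ^ n))"
proof -
  obtain R where R: "R > 0" "\<And>t. t \<in> ball 0 R \<Longrightarrow> \<phi> p + t *s v \<in> \<phi> ` U"
    using line_in_chart[of v] by blast
  define \<rho> where "\<rho> = R / 2"
  have \<rho>: "0 < \<rho>" "\<rho> < R" using R by (simp_all add: \<rho>_def)
  define K where "K = line v ` sphere 0 \<rho>"
  have "continuous_on (sphere 0 \<rho>) (line v)"
    unfolding line_def[abs_def]
  proof (rule continuous_on_compose2[of "\<phi> ` U" \<psi>])
    show "continuous_on (\<phi> ` U) \<psi>" using homeo by (auto simp: homeomorphism_def)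
    show "continuous_on (sphere 0 \<rho>) (\<lambda>t. \<phi> p + t *s v)"
      by (rule has_derivative_continuous_on[OF complex_line_has_derivative])
    show "(\<lambda>t. \<phi> p + t *s v) ` sphere 0 \<rho> \<subseteq> \<phi> ` U" using R(2) \<rho> by auto
  qed
  then have K: "compact K" unfolding K_def by (intro compact_continuous_image compact_sphere)
  have main: "((\<lambda>t. h (line v t) / t ^ n) \<longlongrightarrow> leading v n h) (at 0) \<and>
      (\<forall>M. (\<forall>x\<in>K. cmod (h x) \<le> M) \<longrightarrow> cmod (leading v n h) \<le> M / \<rho> ^ n)"
    if h: "h \<in> hol_funs A" "vanishes_to_order n h" for h n
  proof -
    have hol: "(\<lambda>t. h (line v t)) holomorphic_on ball 0 R"
      unfolding line_def
      using holomorphic_several_on_line[OF hol_funs_in_chart[OF h(1)]]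
      by (rule holomorphic_on_subset) (use R in auto)
    obtain C where C: "\<forall>\<^sub>F t in at 0. cmod (h (line v t)) \<le> C * cmod t ^ n"
      using vanishes_to_order_on_line[OF h(2)] by blast
    obtain l where l: "((\<lambda>t. h (line v t) / t ^ n) \<longlongrightarrow> l) (at 0)"
      "\<forall>M. (\<forall>t. cmod t = \<rho> \<longrightarrow> cmod (h (line v t)) \<le> M) \<longrightarrow> cmod l \<le> M / \<rho> ^ n"
      using leading_coefficient[OF hol \<rho> C] by blast
    then show ?thesis using leading_eqI[OF l(1)] by (auto simp: K_def)
  qed
  show ?thesis using K \<rho>(1) main by blast
qed

lemma leading_tendsto:
  "h \<in> hol_funs A \<Longrightarrow> vanishes_to_order n h \<Longrightarrow>
   ((\<lambda>t. h (line v t) / t ^ n) \<longlongrightarrow> leading v n h) (at 0)"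
  using leading_Cauchy_bound[of v] by blast

lemma leading_eq_0:
  assumes "vanishes_to_order m h" "n < m"
  shows "((\<lambda>t. h (line v t) / t ^ n) \<longlongrightarrow> 0) (at 0)"
proof -
  obtain C where C: "\<forall>\<^sub>F t in at 0. cmod (h (line v t)) \<le> C * cmod t ^ m"
    using vanishes_to_order_on_line[OF assms(1)] by blast
  show ?thesis
  proof (rule Lim_null_comparison)
    have "\<forall>\<^sub>F t in at (0::complex). t \<noteq> 0" by (simp add: eventually_at_filter)
    with C show "\<forall>\<^sub>F t in at 0. cmod (h (line v t) / t ^ n) \<le> C * cmod t ^ (m - n)"
      by eventually_elim (use assms(2) in \<open>simp add: norm_divide norm_power power_diff field_simps\<close>)
    have "((\<lambda>t. C * cmod t ^ (m - n)) \<longlongrightarrow> C * cmod 0 ^ (m - n)) (at 0)"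
      by (intro tendsto_intros)
    then show "((\<lambda>t. C * cmod t ^ (m - n)) \<longlongrightarrow> 0) (at 0)"
      using assms(2) by (simp add: power_0_left)
  qed
qed

section \<open>Weighted composition at a fixed point\<close>

context
  fixes g :: "'a \<Rightarrow> 'a" and D :: "complex ^ 'n \<Rightarrow> complex ^ 'n"
  assumes g_cont: "isCont g p" and g_fix: "g p = p"
    and D: "((\<lambda>z. \<phi> (g (\<psi> z))) has_derivative D) (at (\<phi> p))"
    and D_scale: "\<And>c v. D (c *s v) = c *s D v"
begin

lemma filterlim_fixed_point: "filterlim g (nhds p) (nhds p)"
  using isCont_filterlim_nhds[OF g_cont] g_fix by simp

lemma vanishes_to_order_wcomp:
  assumes w: "isCont w p" and h: "vanishes_to_order n h"
  shows "vanishes_to_order n (wcomp w g h)"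
proof -
  have "vanishes_to_order n (\<lambda>x. h (g x))"
  proof -
    obtain C where C: "C \<ge> 0" "\<forall>\<^sub>F x in nhds p. cmod (h x) \<le> C * norm (\<phi> x - \<phi> p) ^ n"
      using h by (rule vanishes_to_orderE)
    have h': "\<forall>\<^sub>F x in nhds p. cmod (h (g x)) \<le> C * norm (\<phi> (g x) - \<phi> p) ^ n"
      using C(2) filterlim_fixed_point unfolding filterlim_iff by blast
    obtain B where B: "\<And>z. norm (D z) \<le> norm z * B"
      using bounded_linear.bounded[OF has_derivative_bounded_linear[OF D]] by blast
    obtain d where d: "d > 0" "\<And>z. norm (z - \<phi> p) < d \<Longrightarrow>
        norm (\<phi> (g (\<psi> z)) - \<phi> (g (\<psi> (\<phi> p))) - D (z - \<phi> p)) \<le> 1 * norm (z - \<phi> p)"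
      using D unfolding has_derivative_at_alt by (meson zero_less_one)
    have lip: "norm (\<phi> (g (\<psi> z)) - \<phi> p) \<le> (B + 1) * norm (z - \<phi> p)" if "norm (z - \<phi> p) < d" for z
    proof -
      have "norm (\<phi> (g (\<psi> z)) - \<phi> p - D (z - \<phi> p)) \<le> norm (z - \<phi> p)"
        using d(2)[OF that] g_fix p_in by simp
      moreover have "norm (\<phi> (g (\<psi> z)) - \<phi> p) \<le>
          norm (\<phi> (g (\<psi> z)) - \<phi> p - D (z - \<phi> p)) + norm (D (z - \<phi> p))" by norm
      ultimately show ?thesis using B[of "z - \<phi> p"] by (simp add: algebra_simps)
    qed
    have "\<forall>\<^sub>F x in nhds p. dist (\<phi> x) (\<phi> p) < d"
      by (rule tendstoD[OF filterlim_\<phi> d(1)])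
    with eventually_in_U h'
    have "\<forall>\<^sub>F x in nhds p. cmod (h (g x)) \<le> (C * (B + 1) ^ n) * norm (\<phi> x - \<phi> p) ^ n"
    proof eventually_elim
      case (elim x)
      then have "norm (\<phi> (g x) - \<phi> p) \<le> (B + 1) * norm (\<phi> x - \<phi> p)"
        using lip[of "\<phi> x"] by (simp add: dist_norm)
      then have "C * norm (\<phi> (g x) - \<phi> p) ^ n \<le> C * ((B + 1) * norm (\<phi> x - \<phi> p)) ^ n"
        using C(1) by (intro mult_left_mono power_mono) auto
      then show ?case using elim by (simp add: power_mult_distrib mult_ac)
    qed
    then show ?thesis unfolding vanishes_to_order_def by blast
  qed
  from vanishes_to_order_mult[OF isCont_vanishes_to_order_0[OF w] this]
  show ?thesis by (simp add: wcomp_def)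
qed

lemma weight_on_line: "isCont w p \<Longrightarrow> ((\<lambda>t. w (line v t)) \<longlongrightarrow> w p) (at 0)"
  using isCont_tendsto_compose line_tendsto by blast

text \<open>
  To first order \<open>g\<close> maps the line through \<open>p\<close> in the direction \<open>v\<close> to itself, with speed \<open>\<alpha>\<close>.
\<close>

lemma derivative_on_line:
  assumes "D v = \<alpha> *s v"
  shows "((\<lambda>t. norm (\<phi> (g (line v t)) - (\<phi> p + (\<alpha> * t) *s v)) / cmod t) \<longlongrightarrow> 0) (at 0)"
proof -
  have D': "((\<lambda>z. \<phi> (g (\<psi> z))) has_derivative D) (at (\<phi> p + 0 *s v))" using D by simp
  have "((\<lambda>t. \<phi> (g (line v t))) has_derivative (\<lambda>t. D (t *s v))) (at 0)"
    unfolding line_def using has_derivative_compose[OF complex_line_has_derivative D'] .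
  then have "((\<lambda>t. norm (\<phi> (g (line v (0 + t))) - \<phi> (g (line v 0)) - D (t *s v)) / norm t)
      \<longlongrightarrow> 0) (at 0)"
    unfolding has_derivative_at by blast
  then show ?thesis
    using g_fix p_in by (simp add: D_scale assms line_def diff_diff_eq mult.commute)
qed

text \<open>
  Along the direction of an eigenvector \<open>g\<close> acts like \<open>t \<mapsto> \<alpha> t\<close> up to \<open>o(t)\<close>, which by Cauchy's
  estimate does not influence the coefficient of \<open>t\<^sup>n\<close>.
\<close>

lemma leading_wcomp:
  assumes v: "D v = \<alpha> *s v" and \<alpha>: "\<alpha> \<noteq> 0" and w: "isCont w p"
    and h: "h \<in> hol_funs A" "vanishes_to_order n h"
  shows "((\<lambda>t. wcomp w g h (line v t) / t ^ n) \<longlongrightarrow> w p * \<alpha> ^ n * leading v n h) (at 0)"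
proof -
  define H where "H = (\<lambda>z. h (\<psi> z))"
  define c1 where "c1 = (\<lambda>t. \<phi> p + (\<alpha> * t) *s v)"
  define c2 where "c2 = (\<lambda>t. \<phi> (g (line v t)))"
  obtain C \<rho> where C: "C \<ge> 0" "\<rho> > 0" "ball (\<phi> p) \<rho> \<subseteq> \<phi> ` U"
    "\<And>z. z \<in> ball (\<phi> p) \<rho> \<Longrightarrow> cmod (h (\<psi> z)) \<le> C * norm (z - \<phi> p) ^ n"
    using vanishes_to_order_in_chart[OF h(2)] by blast
  have "((\<lambda>t. (H (c2 t) - H (c1 t)) / t ^ n) \<longlongrightarrow> 0) (at 0)"
  proof (rule increment_of_higher_order)
    show "holomorphic_several H (\<phi> ` U)" unfolding H_def by (rule hol_funs_in_chart[OF h(1)])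
    show "norm (c1 t - \<phi> p) \<le> (cmod \<alpha> * norm v) * cmod t" for t
      by (simp add: c1_def norm_vector_scale norm_mult mult_ac)
    show "((\<lambda>t. norm (c2 t - c1 t) / cmod t) \<longlongrightarrow> 0) (at 0)"
      using derivative_on_line[OF v] by (simp add: c1_def c2_def)
  qed (use C in \<open>auto simp: H_def\<close>)
  moreover have "((\<lambda>t. H (c1 t) / t ^ n) \<longlongrightarrow> \<alpha> ^ n * leading v n h) (at 0)"
  proof -
    have "filterlim (\<lambda>t. \<alpha> * t) (at 0) (at 0)"
    proof (rule filterlim_atI)
      have "((\<lambda>t. \<alpha> * t) \<longlongrightarrow> \<alpha> * 0) (at 0)" by (intro tendsto_intros)
      then show "((\<lambda>t. \<alpha> * t) \<longlongrightarrow> 0) (at 0)" by simp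
      show "\<forall>\<^sub>F t in at 0. \<alpha> * t \<noteq> 0" using \<alpha> by (simp add: eventually_at_filter)
    qed
    from filterlim_compose[OF leading_tendsto[OF h] this]
    have "((\<lambda>t. h (line v (\<alpha> * t)) / (\<alpha> * t) ^ n) \<longlongrightarrow> leading v n h) (at 0)" .
    from tendsto_mult_left[OF this, of "\<alpha> ^ n"] show ?thesis
      using \<alpha> by (simp add: H_def c1_def line_def power_mult_distrib)
  qed
  ultimately have "((\<lambda>t. (H (c2 t) - H (c1 t)) / t ^ n + H (c1 t) / t ^ n)
      \<longlongrightarrow> 0 + \<alpha> ^ n * leading v n h) (at 0)"
    by (rule tendsto_add)
  then have "((\<lambda>t. H (c2 t) / t ^ n) \<longlongrightarrow> \<alpha> ^ n * leading v n h) (at 0)"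
    by (simp add: diff_divide_distrib)
  from tendsto_mult[OF weight_on_line[OF w] this]
  have lim: "((\<lambda>t. w (line v t) * (H (c2 t) / t ^ n)) \<longlongrightarrow> w p * (\<alpha> ^ n * leading v n h)) (at 0)" .
  have "\<forall>\<^sub>F x in nhds p. g x \<in> U"
    using eventually_in_U filterlim_fixed_point unfolding filterlim_iff by blast
  then have "\<forall>\<^sub>F t in at 0. g (line v t) \<in> U"
    using line_tendsto unfolding filterlim_iff by blast
  then have "\<forall>\<^sub>F t in at 0. w (line v t) * (H (c2 t) / t ^ n) = wcomp w g h (line v t) / t ^ n"
    by eventually_elim (simp add: H_def c2_def wcomp_def)
  from Lim_transform_eventually[OF lim this] show ?thesis by (simp add: mult.assoc)
qed

text \<open>
  The germ \<open>(\<phi>\<^sub>i - \<phi>\<^sub>i(p))\<^sup>n\<close> is homogeneous of degree \<open>n\<close>, hence its pull-back has on the line through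
  an eigenvector the leading coefficient \<open>w(p) (\<alpha> v\<^sub>i)\<^sup>n\<close>.
\<close>

lemma leading_wcomp_coordinate_power:
  assumes v: "D v = \<alpha> *s v" and w: "isCont w p"
  shows "((\<lambda>t. wcomp w g (\<lambda>x. (\<phi> x $ i - \<phi> p $ i) ^ n) (line v t) / t ^ n)
    \<longlongrightarrow> w p * (\<alpha> * v $ i) ^ n) (at 0)"
proof -
  have "((\<lambda>t. (\<phi> (g (line v t)) $ i - \<phi> p $ i) / t - \<alpha> * v $ i) \<longlongrightarrow> 0) (at 0)"
  proof (rule Lim_null_comparison[OF _ derivative_on_line[OF v]])
    have "\<forall>\<^sub>F t in at (0::complex). t \<noteq> 0" by (simp add: eventually_at_filter)
    then show "\<forall>\<^sub>F t in at 0. cmod ((\<phi> (g (line v t)) $ i - \<phi> p $ i) / t - \<alpha> * v $ i)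
        \<le> norm (\<phi> (g (line v t)) - (\<phi> p + (\<alpha> * t) *s v)) / cmod t"
    proof eventually_elim
      case (elim t)
      have "(\<phi> (g (line v t)) $ i - \<phi> p $ i) / t - \<alpha> * v $ i =
          (\<phi> (g (line v t)) - (\<phi> p + (\<alpha> * t) *s v)) $ i / t"
        using elim by (simp add: field_simps)
      then show ?case
        using Finite_Cartesian_Product.norm_nth_le[of "\<phi> (g (line v t)) - (\<phi> p + (\<alpha> * t) *s v)" i]
        by (simp add: norm_divide divide_right_mono)
    qed
  qed
  then have "((\<lambda>t. (\<phi> (g (line v t)) $ i - \<phi> p $ i) / t) \<longlongrightarrow> \<alpha> * v $ i) (at 0)"
    by (simp add: LIM_zero_iff)
  from tendsto_mult[OF weight_on_line[OF w] tendsto_power[OF this, of n]]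
  show ?thesis by (simp add: wcomp_def power_divide)
qed

end

end

section \<open>Germs\<close>

lemma germ_at_self: "h \<in> germ_at p h"
  by (simp add: germ_at_def)

lemma germ_ring_multI:
  "g \<in> a \<Longrightarrow> h \<in> b \<Longrightarrow> \<forall>\<^sub>F x in nhds p. k x = g x * h x \<Longrightarrow> k \<in> a \<otimes>\<^bsub>germ_ring A p\<^esub> b"
  by (auto simp: germ_ring_def)

lemma germ_ring_addI:
  "g \<in> a \<Longrightarrow> h \<in> b \<Longrightarrow> \<forall>\<^sub>F x in nhds p. k x = g x + h x \<Longrightarrow> k \<in> a \<oplus>\<^bsub>germ_ring A p\<^esub> b"
  by (auto simp: germ_ring_def)

lemma germ_ring_mult:
  "germ_at p g \<otimes>\<^bsub>germ_ring A p\<^esub> germ_at p h = germ_at p (\<lambda>x. g x * h x)"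
proof (intro equalityI subsetI)
  fix k assume "k \<in> germ_at p g \<otimes>\<^bsub>germ_ring A p\<^esub> germ_at p h"
  then obtain g' h' where "\<forall>\<^sub>F x in nhds p. g' x = g x" "\<forall>\<^sub>F x in nhds p. h' x = h x"
    "\<forall>\<^sub>F x in nhds p. k x = g' x * h' x"
    by (auto simp: germ_ring_def germ_at_def)
  then have "\<forall>\<^sub>F x in nhds p. k x = g x * h x" by eventually_elim simp
  then show "k \<in> germ_at p (\<lambda>x. g x * h x)" by (simp add: germ_at_def)
next
  fix k assume "k \<in> germ_at p (\<lambda>x. g x * h x)"
  then show "k \<in> germ_at p g \<otimes>\<^bsub>germ_ring A p\<^esub> germ_at p h"
    by (intro germ_ring_multI[OF germ_at_self germ_at_self]) (simp add: germ_at_def)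
qed

lemma germ_ring_add_zero:
  "germ_at p (\<lambda>x. 0) \<oplus>\<^bsub>germ_ring A p\<^esub> germ_at p h = germ_at p h"
proof (intro equalityI subsetI)
  fix k assume "k \<in> germ_at p (\<lambda>x. 0) \<oplus>\<^bsub>germ_ring A p\<^esub> germ_at p h"
  then obtain g' h' where "\<forall>\<^sub>F x in nhds p. g' x = 0" "\<forall>\<^sub>F x in nhds p. h' x = h x"
    "\<forall>\<^sub>F x in nhds p. k x = g' x + h' x"
    by (auto simp: germ_ring_def germ_at_def)
  then have "\<forall>\<^sub>F x in nhds p. k x = h x" by eventually_elim simp
  then show "k \<in> germ_at p h" by (simp add: germ_at_def)
next
  fix k assume k: "k \<in> germ_at p h"
  then show "k \<in> germ_at p (\<lambda>x. 0) \<oplus>\<^bsub>germ_ring A p\<^esub> germ_at p h"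
    by (intro germ_ring_addI[OF germ_at_self k]) simp
qed

lemma holomorphic_fun_on_const: "holomorphic_fun_on A W (\<lambda>x. c)"
  unfolding holomorphic_fun_on_def holomorphic_several_def
  by (auto intro!: exI[of _ "\<lambda>_. 0"])

lemma const_in_hol_germs: "germ_at p (\<lambda>x. c) \<in> hol_germs A p"
  unfolding hol_germs_def using holomorphic_fun_on_const[of A UNIV c] by blast

lemma germ_in_max_ideal:
  assumes "germ_at p h \<in> hol_germs A p" "h p = 0"
  shows "germ_at p h \<in> max_ideal A p"
proof -
  have "g p = 0" if "g \<in> germ_at p h" for g
    using that assms(2) eventually_nhds_x_imp_x[of "\<lambda>x. g x = h x" p] by (simp add: germ_at_def)
  then show ?thesis using assms by (auto simp: max_ideal_def)
qed

lemma germ_power_in_max_ideal_pow: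
  assumes "germ_at p q \<in> max_ideal A p"
  shows "germ_at p (\<lambda>x. q x ^ n) \<in> max_ideal_pow A p n"
proof (induction n)
  case 0
  then show ?case using const_in_hol_germs[of p 1 A] by (simp add: germ_ring_def)
next
  case (Suc n)
  have "germ_at p q \<otimes>\<^bsub>germ_ring A p\<^esub> germ_at p (\<lambda>x. q x ^ n)
      \<in> ideal_prod (germ_ring A p) (max_ideal A p) (max_ideal_pow A p n)"
    using assms Suc.IH by (rule ideal_prod.prod)
  then show ?case by (simp add: germ_ring_mult)
qed

lemma zero_in_max_ideal_pow: "germ_at p (\<lambda>x. 0) \<in> max_ideal_pow A p n"
proof (induction n)
  case 0
  then show ?case using const_in_hol_germs[of p 0 A] by (simp add: germ_ring_def)
next
  case (Suc n)
  have "germ_at p (\<lambda>x. 0) \<otimes>\<^bsub>germ_ring A p\<^esub> germ_at p (\<lambda>x. 0)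
      \<in> ideal_prod (germ_ring A p) (max_ideal A p) (max_ideal_pow A p n)"
    using germ_in_max_ideal[OF const_in_hol_germs] Suc.IH by (intro ideal_prod.prod) auto
  then show ?case by (simp add: germ_ring_mult)
qed

context chart_at
begin

text \<open>
  A germ in the maximal ideal is \<open>O(|z|)\<close> by differentiability; products and sums of estimates
  then follow the inductive description of the product of ideals.
\<close>

lemma max_ideal_pow_vanishes:
  assumes "a \<in> max_ideal_pow A p n" "h \<in> a"
  shows "vanishes_to_order n h"
  using assms
proof (induction n arbitrary: a h)
  case 0
  then obtain h' W where h': "a = germ_at p h'" "open W" "p \<in> W" "holomorphic_fun_on A W h'"
    by (auto simp: germ_ring_def hol_germs_def)
  then have "vanishes_to_order 0 h'"
    using isCont_vanishes_to_order_0 holomorphic_fun_isCont by blast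
  moreover have "\<forall>\<^sub>F x in nhds p. h x = h' x" using 0 h' by (simp add: germ_at_def)
  ultimately show ?case using vanishes_to_order_cong by blast
next
  case (Suc n)
  from Suc.prems(1)
  have "a \<in> ideal_prod (germ_ring A p) (max_ideal A p) (max_ideal_pow A p n)" by simp
  then have "\<forall>h\<in>a. vanishes_to_order (Suc n) h"
  proof induction
    case (prod i j)
    show ?case
    proof
      fix h assume "h \<in> i \<otimes>\<^bsub>germ_ring A p\<^esub> j"
      then obtain k l where kl: "k \<in> i" "l \<in> j" "\<forall>\<^sub>F x in nhds p. h x = k x * l x"
        by (auto simp: germ_ring_def)
      obtain h' W where h': "i = germ_at p h'" "open W" "p \<in> W" "holomorphic_fun_on A W h'"
        using prod(1) by (auto simp: max_ideal_def hol_germs_def)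
      have "h' p = 0" using prod(1) germ_at_self[of h' p] h'(1) by (simp add: max_ideal_def)
      moreover obtain D where "((\<lambda>z. h' (\<psi> z)) has_derivative D) (at (\<phi> p))"
        using holomorphic_fun_in_chart[OF h'(2-4)] by blast
      ultimately have "vanishes_to_order 1 h'" using differentiable_vanishes_to_order_1 by blast
      moreover have "\<forall>\<^sub>F x in nhds p. k x = h' x" using kl h' by (simp add: germ_at_def)
      ultimately have "vanishes_to_order 1 k" using vanishes_to_order_cong by blast
      moreover have "vanishes_to_order n l" using Suc.IH prod(2) kl(2) .
      ultimately have "vanishes_to_order (1 + n) (\<lambda>x. k x * l x)"
        by (rule vanishes_to_order_mult)
      then show "vanishes_to_order (Suc n) h" using vanishes_to_order_cong[OF kl(3)] by simp
    qed
  next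
    case (sum s1 s2)
    show ?case
    proof
      fix h assume "h \<in> s1 \<oplus>\<^bsub>germ_ring A p\<^esub> s2"
      then obtain k l where kl: "k \<in> s1" "l \<in> s2" "\<forall>\<^sub>F x in nhds p. h x = k x + l x"
        by (auto simp: germ_ring_def)
      then have "vanishes_to_order (Suc n) (\<lambda>x. k x + l x)"
        using sum vanishes_to_order_add by blast
      then show "vanishes_to_order (Suc n) h" using vanishes_to_order_cong[OF kl(3)] by simp
    qed
  qed
  then show ?case using Suc.prems(2) by blast
qed

lemma coordinate_in_max_ideal: "germ_at p (\<lambda>x. \<phi> x $ i - \<phi> p $ i) \<in> max_ideal A p"
proof (rule germ_in_max_ideal)
  have "holomorphic_fun_on A U (\<lambda>x. \<phi> x $ i - \<phi> p $ i)"
    unfolding holomorphic_fun_on_def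
  proof (intro ballI, clarify)
    fix W \<zeta> assume W: "(W, \<zeta>) \<in> A"
    have hol: "holomorphic_several (\<lambda>z. \<phi> (inv_into W \<zeta> z) $ i) (\<zeta> ` (W \<inter> U))"
      using manifold W chart unfolding complex_manifold_def by blast
    show "holomorphic_several (\<lambda>z. \<phi> (inv_into W \<zeta> z) $ i - \<phi> p $ i) (\<zeta> ` (W \<inter> U))"
      unfolding holomorphic_several_def
    proof
      fix z assume "z \<in> \<zeta> ` (W \<inter> U)"
      then obtain D where D: "((\<lambda>z. \<phi> (inv_into W \<zeta> z) $ i) has_derivative D) (at z)"
        "\<forall>c v. D (c *s v) = c * D v"
        using hol unfolding holomorphic_several_def by blast
      have "((\<lambda>z. \<phi> (inv_into W \<zeta> z) $ i - \<phi> p $ i) has_derivative (\<lambda>v. D v - 0)) (at z)"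
        using D(1) by (intro has_derivative_diff has_derivative_const)
      then show "\<exists>D. ((\<lambda>z. \<phi> (inv_into W \<zeta> z) $ i - \<phi> p $ i) has_derivative D) (at z)
          \<and> (\<forall>c v. D (c *s v) = c * D v)"
        using D(2) by auto
    qed
  qed
  then show "germ_at p (\<lambda>x. \<phi> x $ i - \<phi> p $ i) \<in> hol_germs A p"
    unfolding hol_germs_def using open_U p_in by blast
qed simp

text \<open>
  The hypothesis equates the image of the coset of \<open>q\<close> with the coset of some \<open>h \<in> V\<close>.  The pull-back of
  \<open>q\<close> itself belongs to that image, as a sum with the zero germ, so it differs from \<open>h\<close> by a germ
  in the next power of the maximal ideal.
\<close>

lemma graded_image_lift:
  assumes gr: "gr_map A p n w g ` gr_space A (g p) n \<subseteq> V_gr A V p n" and fixed: "g p = p"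
    and q: "germ_at p q \<in> max_ideal_pow A p n"
  obtains h where "h \<in> V" "vanishes_to_order n h"
    "vanishes_to_order (Suc n) (\<lambda>x. wcomp w g q x - h x)"
proof -
  let ?R = "germ_ring A p" and ?I = "max_ideal_pow A p (Suc n)" and ?z = "germ_at p (\<lambda>x. 0)"
  have z: "?z \<in> ?I" by (rule zero_in_max_ideal_pow)
  define C where "C = ?I +>\<^bsub>?R\<^esub> germ_at p q"
  have "C \<in> gr_space A (g p) n" using q unfolding C_def gr_space_def fixed by blast
  then have "gr_map A p n w g C \<in> V_gr A V p n" using gr by blast
  then obtain h where h: "h \<in> V" "germ_at p h \<in> max_ideal_pow A p n"
    "?I <+>\<^bsub>?R\<^esub> (germ_wpull p w g ` C) = ?I +>\<^bsub>?R\<^esub> germ_at p h"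
    unfolding V_gr_def V_filt_def gr_map_def by blast
  have "?z \<oplus>\<^bsub>?R\<^esub> germ_at p q \<in> C" unfolding C_def a_r_coset_def' using z by blast
  then have "germ_at p q \<in> C" by (simp only: germ_ring_add_zero)
  then have "?z \<oplus>\<^bsub>?R\<^esub> germ_wpull p w g (germ_at p q) \<in> ?I <+>\<^bsub>?R\<^esub> (germ_wpull p w g ` C)"
    unfolding set_add_def' using z by blast
  then obtain a where a: "a \<in> ?I"
    "?z \<oplus>\<^bsub>?R\<^esub> germ_wpull p w g (germ_at p q) = a \<oplus>\<^bsub>?R\<^esub> germ_at p h"
    unfolding h(3) a_r_coset_def' by blast
  have "wcomp w g q \<in> germ_wpull p w g (germ_at p q)"
    unfolding germ_wpull_def wcomp_def using germ_at_self[of q p] by (auto intro!: bexI[of _ q])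
  then have "wcomp w g q \<in> ?z \<oplus>\<^bsub>?R\<^esub> germ_wpull p w g (germ_at p q)"
    by (rule germ_ring_addI[OF germ_at_self]) simp
  then have "wcomp w g q \<in> a \<oplus>\<^bsub>?R\<^esub> germ_at p h" by (simp only: a(2))
  then obtain k l where kl: "k \<in> a" "\<forall>\<^sub>F x in nhds p. l x = h x"
    "\<forall>\<^sub>F x in nhds p. wcomp w g q x = k x + l x"
    by (auto simp: germ_ring_def germ_at_def)
  from kl(2,3) have "\<forall>\<^sub>F x in nhds p. wcomp w g q x - h x = k x" by eventually_elim simp
  from vanishes_to_order_cong[OF this]
  have "vanishes_to_order (Suc n) (\<lambda>x. wcomp w g q x - h x)"
    using max_ideal_pow_vanishes[OF a(1) kl(1)] by simp
  moreover have "vanishes_to_order n h"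
    using max_ideal_pow_vanishes[OF h(2) germ_at_self] .
  ultimately show thesis using that h(1) by blast
qed

end

section \<open>Iterates of holomorphic maps\<close>

lemma has_derivative_vector_components:
  fixes f :: "'b::real_normed_vector \<Rightarrow> complex ^ 'n"
  assumes "\<And>i. ((\<lambda>x. f x $ i) has_derivative (\<lambda>x. D x $ i)) (at a)"
  shows "(f has_derivative D) (at a)"
proof (subst has_derivative_componentwise_within, intro ballI)
  fix b :: "complex ^ 'n" assume "b \<in> Basis"
  then obtain i u where "b = axis i u" by (auto simp: Basis_vec_def)
  then show "((\<lambda>x. f x \<bullet> b) has_derivative (\<lambda>x. D x \<bullet> b)) (at a)"
    using has_derivative_inner_left[OF assms[of i], of u] by (simp add: inner_axis)
qed

text \<open>
  The pointwise content of holomorphy for maps, with one vector-valued derivative in place of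
  its components: in this form the chain rule composes derivatives through any chart.
\<close>

definition complex_differentiable_map ::
    "('a::t2_space, 'n::finite) atlas \<Rightarrow> ('a \<Rightarrow> 'a) \<Rightarrow> bool" where
  "complex_differentiable_map A g \<longleftrightarrow>
     (\<forall>(U, \<phi>)\<in>A. \<forall>(W, \<zeta>)\<in>A. \<forall>x. x \<in> U \<longrightarrow> g x \<in> W \<longrightarrow>
        (\<exists>D. ((\<lambda>z. \<zeta> (g (inv_into U \<phi> z))) has_derivative D) (at (\<phi> x)) \<and>
             (\<forall>c v. D (c *s v) = c *s D v)))"

lemma complex_differentiable_mapD:
  assumes "complex_differentiable_map A g" "(U, \<phi>) \<in> A" "(W, \<zeta>) \<in> A" "x \<in> U" "g x \<in> W"
  obtains D where "((\<lambda>z. \<zeta> (g (inv_into U \<phi> z))) has_derivative D) (at (\<phi> x))"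
    "\<And>c v. D (c *s v) = c *s D v"
  using assms unfolding complex_differentiable_map_def by blast

lemma complex_derivative_from_components:
  fixes F :: "complex ^ 'n \<Rightarrow> complex ^ 'm"
  assumes "\<And>i. holomorphic_several (\<lambda>z. F z $ i) S" "z \<in> S"
  shows "\<exists>D. (F has_derivative D) (at z) \<and> (\<forall>c v. D (c *s v) = c *s D v)"
proof -
  have "\<exists>D. ((\<lambda>z. F z $ i) has_derivative D) (at z) \<and> (\<forall>c v. D (c *s v) = c * D v)" for i
    using assms unfolding holomorphic_several_def by blast
  then obtain D where D: "\<And>i. ((\<lambda>z. F z $ i) has_derivative D i) (at z)"
    "\<And>i c v. D i (c *s v) = c * D i v"
    by metis
  have "(F has_derivative (\<lambda>v. \<chi> i. D i v)) (at z)"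
    by (rule has_derivative_vector_components) (simp add: D(1))
  then show ?thesis using D(2) by (intro exI[of _ "\<lambda>v. \<chi> i. D i v"]) (simp add: vec_eq_iff)
qed

lemma complex_differentiable_map_id:
  assumes "complex_manifold A"
  shows "complex_differentiable_map A (\<lambda>x. x)"
  unfolding complex_differentiable_map_def
proof (intro ballI, clarify)
  fix U \<phi> W \<zeta> x assume UW: "(U, \<phi>) \<in> A" "(W, \<zeta>) \<in> A" and x: "x \<in> U" "x \<in> W"
  have "holomorphic_several (\<lambda>z. \<zeta> (inv_into U \<phi> z) $ i) (\<phi> ` (U \<inter> W))" for i
    using assms UW unfolding complex_manifold_def by blast
  moreover have "\<phi> x \<in> \<phi> ` (U \<inter> W)" using x by blast
  ultimately show "\<exists>D. ((\<lambda>z. \<zeta> (inv_into U \<phi> z)) has_derivative D) (at (\<phi> x)) \<and>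
      (\<forall>c v. D (c *s v) = c *s D v)"
    by (rule complex_derivative_from_components)
qed

lemma holomorphic_self_map_complex_differentiable:
  assumes "holomorphic_self_map A f"
  shows "complex_differentiable_map A f"
  unfolding complex_differentiable_map_def
proof (intro ballI, clarify)
  fix U \<phi> W \<zeta> x assume UW: "(U, \<phi>) \<in> A" "(W, \<zeta>) \<in> A" and x: "x \<in> U" "f x \<in> W"
  have "holomorphic_several (\<lambda>z. \<zeta> (f (inv_into U \<phi> z)) $ i) (\<phi> ` (U \<inter> f -` W))" for i
    using assms UW unfolding holomorphic_self_map_def by blast
  moreover have "\<phi> x \<in> \<phi> ` (U \<inter> f -` W)" using x by blast
  ultimately show "\<exists>D. ((\<lambda>z. \<zeta> (f (inv_into U \<phi> z))) has_derivative D) (at (\<phi> x)) \<and>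
      (\<forall>c v. D (c *s v) = c *s D v)"
    by (rule complex_derivative_from_components)
qed

text \<open>
  The chain rule, through an intermediate chart around \<open>g x\<close>; continuity of \<open>g\<close> keeps the points
  near \<open>x\<close> inside that chart.
\<close>

lemma complex_differentiable_map_comp:
  assumes A: "complex_manifold A" and f: "complex_differentiable_map A f"
    and g: "complex_differentiable_map A g" "continuous_on UNIV g"
  shows "complex_differentiable_map A (\<lambda>x. f (g x))"
  unfolding complex_differentiable_map_def
proof (intro ballI, clarify)
  fix U \<phi> W \<zeta> x assume UW: "(U, \<phi>) \<in> A" "(W, \<zeta>) \<in> A" and x: "x \<in> U" "f (g x) \<in> W"
  interpret chart_at A U \<phi> x using A UW x by unfold_locales
  have "g x \<in> (\<Union>(U, \<phi>)\<in>A. U)" using A unfolding complex_manifold_def by simp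
  then obtain Z \<xi> where Z: "(Z, \<xi>) \<in> A" "g x \<in> Z" by blast
  interpret Z: chart_at A Z \<xi> "g x" using A Z by unfold_locales
  obtain D1 where D1: "((\<lambda>z. \<xi> (g (inv_into U \<phi> z))) has_derivative D1) (at (\<phi> x))"
    "\<And>c v. D1 (c *s v) = c *s D1 v"
    using complex_differentiable_mapD[OF g(1) UW(1) Z(1) x(1) Z(2)] by blast
  obtain D2 where D2: "((\<lambda>z. \<zeta> (f (inv_into Z \<xi> z))) has_derivative D2) (at (\<xi> (g x)))"
    "\<And>c v. D2 (c *s v) = c *s D2 v"
    using complex_differentiable_mapD[OF f Z(1) UW(2) Z(2) x(2)] by blast
  have "((\<lambda>z. \<zeta> (f (inv_into Z \<xi> z))) has_derivative D2) (at (\<xi> (g (inv_into U \<phi> (\<phi> x)))))"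
    using D2(1) x(1) by simp
  from has_derivative_compose[OF D1(1) this]
  have comp: "((\<lambda>z. \<zeta> (f (inv_into Z \<xi> (\<xi> (g (inv_into U \<phi> z))))))
      has_derivative (\<lambda>v. D2 (D1 v))) (at (\<phi> x))" .
  have "filterlim g (nhds (g x)) (nhds x)"
    using g(2) by (intro isCont_filterlim_nhds) (simp add: continuous_on_eq_continuous_at)
  from filterlim_compose[OF this filterlim_\<psi>] Z.eventually_in_U
  have ev: "\<forall>\<^sub>F z in nhds (\<phi> x). g (inv_into U \<phi> z) \<in> Z"
    unfolding filterlim_iff by blast
  then have ev': "\<forall>\<^sub>F z in at (\<phi> x).
      \<zeta> (f (inv_into Z \<xi> (\<xi> (g (inv_into U \<phi> z))))) = \<zeta> (f (g (inv_into U \<phi> z)))"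
    unfolding eventually_at_filter by eventually_elim simp
  have "((\<lambda>z. \<zeta> (f (g (inv_into U \<phi> z)))) has_derivative (\<lambda>v. D2 (D1 v))) (at (\<phi> x))"
    by (rule has_derivative_transform_eventually[OF comp ev']) (use Z x in simp_all)
  then show "\<exists>D. ((\<lambda>z. \<zeta> (f (g (inv_into U \<phi> z)))) has_derivative D) (at (\<phi> x)) \<and>
      (\<forall>c v. D (c *s v) = c *s D v)"
    using D1(2) D2(2) by (intro exI[of _ "\<lambda>v. D2 (D1 v)"]) simp
qed

lemma holomorphic_self_map_funpow:
  assumes A: "complex_manifold A" and f: "holomorphic_self_map A f"
  shows "continuous_on UNIV (f ^^ r)" "complex_differentiable_map A (f ^^ r)"
proof (induction r)
  case 0
  show "continuous_on UNIV (f ^^ 0)" by (simp add: continuous_on_id)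
  show "complex_differentiable_map A (f ^^ 0)"
    using complex_differentiable_map_id[OF A] by (simp add: id_def)
next
  case (Suc r)
  have "continuous_on UNIV f" using f by (simp add: holomorphic_self_map_def)
  then show "continuous_on UNIV (f ^^ Suc r)"
    using Suc.IH(1) continuous_on_compose2[of UNIV f UNIV "f ^^ r"] by (simp add: o_def)
  have "complex_differentiable_map A (\<lambda>x. f ((f ^^ r) x))"
    using A holomorphic_self_map_complex_differentiable[OF f] Suc.IH(2,1)
    by (rule complex_differentiable_map_comp)
  then show "complex_differentiable_map A (f ^^ Suc r)" by (simp add: o_def)
qed

lemma matrix_mult_complex_linear:
  fixes D :: "complex ^ 'n \<Rightarrow> complex ^ 'm"
  assumes "bounded_linear D" "\<And>c v. D (c *s v) = c *s D v"
  shows "matrix D *v v = D v"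
proof (rule matrix_works)
  show "Vector_Spaces.linear (*s) (*s) D"
    using assms(2) linear_add[OF bounded_linear.linear[OF assms(1)]]
    by unfold_locales (auto simp: vector_add_ldistrib vector_sadd_rdistrib)
qed

section \<open>Iterates of weighted composition operators\<close>

lemma wcomp_funpow:
  "(wcomp u f ^^ r) h = wcomp (\<lambda>x. \<Prod>j<r. u ((f ^^ j) x)) (f ^^ r) h"
proof (induction r)
  case 0
  then show ?case by (simp add: wcomp_def)
next
  case (Suc r)
  show ?case
  proof
    fix x
    have "(\<Prod>j<Suc r. u ((f ^^ j) x)) = u x * (\<Prod>j<r. u ((f ^^ j) (f x)))"
      by (simp add: prod.lessThan_Suc_shift funpow_Suc_right del: funpow.simps(2) prod.lessThan_Suc)
    then show "(wcomp u f ^^ Suc r) h x =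
        wcomp (\<lambda>x. \<Prod>j<Suc r. u ((f ^^ j) x)) (f ^^ Suc r) h x"
      by (simp only: funpow.simps(2) o_def Suc) (simp add: wcomp_def funpow_swap1)
  qed
qed

lemma wcomp_bounded_funpow:
  assumes V: "quasi_norm_on V N" and b: "wcomp_bounded V N u f"
  shows "\<exists>C>0. \<forall>h\<in>V. (wcomp u f ^^ r) h \<in> V \<and> N ((wcomp u f ^^ r) h) \<le> C * N h"
proof (induction r)
  case 0
  show ?case by (intro exI[of _ 1]) simp
next
  case (Suc r)
  obtain B where B: "\<And>h. h \<in> V \<Longrightarrow> wcomp u f h \<in> V" "\<And>h. h \<in> V \<Longrightarrow> N (wcomp u f h) \<le> B * N h"
    using b unfolding wcomp_bounded_def wcomp_domain_def by blast
  obtain C where C: "C > 0"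
    "\<And>h. h \<in> V \<Longrightarrow> (wcomp u f ^^ r) h \<in> V \<and> N ((wcomp u f ^^ r) h) \<le> C * N h"
    using Suc.IH by blast
  have "N (wcomp u f ((wcomp u f ^^ r) h)) \<le> (\<bar>B\<bar> + 1) * C * N h" if h: "h \<in> V" for h
  proof -
    have pos: "N ((wcomp u f ^^ r) h) \<ge> 0" using quasi_norm_nonneg[OF V] C(2)[OF h] by blast
    have "N (wcomp u f ((wcomp u f ^^ r) h)) \<le> B * N ((wcomp u f ^^ r) h)"
      using B(2) C(2)[OF h] by blast
    also have "\<dots> \<le> (\<bar>B\<bar> + 1) * N ((wcomp u f ^^ r) h)"
      using pos by (intro mult_right_mono) auto
    also have "\<dots> \<le> (\<bar>B\<bar> + 1) * (C * N h)"
      using C(2)[OF h] by (intro mult_left_mono) auto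
    finally show ?thesis by (simp add: mult.assoc)
  qed
  moreover have "(\<bar>B\<bar> + 1) * C > 0" using C(1) by simp
  ultimately show ?case using B(1) C(2) by (intro exI[of _ "(\<bar>B\<bar> + 1) * C"]) auto
qed

lemma wcomp_compact_imp_compact_set:
  assumes "complex_function_space V" "wcomp_compact V N u f"
  obtains Q where "compactin (quasi_norm_topology V N) Q" "\<And>h. h \<in> V \<Longrightarrow> N h \<le> 1 \<Longrightarrow> wcomp u f h \<in> Q"
proof
  let ?X = "quasi_norm_topology V N"
  show "compactin ?X (?X closure_of (wcomp u f ` {h \<in> V. N h \<le> 1}))"
    using assms(2) by (simp add: wcomp_compact_def)
  have "openin ?X V" unfolding openin_quasi_norm_topology using zero_less_one by blast
  then have "V \<subseteq> topspace ?X" by (rule openin_subset)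
  moreover have "wcomp u f h \<in> V" if "h \<in> V" for h
    using assms(2) that unfolding wcomp_compact_def wcomp_domain_def by blast
  ultimately have "wcomp u f ` {h \<in> V. N h \<le> 1} \<subseteq> topspace ?X" by blast
  then show "wcomp u f h \<in> ?X closure_of (wcomp u f ` {h \<in> V. N h \<le> 1})"
    if "h \<in> V" "N h \<le> 1" for h
    using closure_of_subset that by blast
qed

lemma wcomp_scale: "wcomp u f (\<lambda>x. c * h x) = (\<lambda>x. c * wcomp u f h x)"
  by (simp add: wcomp_def mult_ac)

lemma wcomp_compact_imp_bounded:
  assumes V: "complex_function_space V" "quasi_norm_on V N" and c: "wcomp_compact V N u f"
  shows "wcomp_bounded V N u f"
proof -
  obtain Q where Q: "compactin (quasi_norm_topology V N) Q"
    "\<And>h. h \<in> V \<Longrightarrow> N h \<le> 1 \<Longrightarrow> wcomp u f h \<in> Q"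
    using wcomp_compact_imp_compact_set[OF V(1) c] by blast
  obtain C where C: "\<And>h. h \<in> Q \<Longrightarrow> N h \<le> C"
    using compactin_quasi_norm_bounded[OF V Q(1)] by blast
  have dom: "wcomp_domain V u f = V" using c by (simp add: wcomp_compact_def)
  then have inV: "wcomp u f h \<in> V" if "h \<in> V" for h
    using that unfolding wcomp_domain_def by blast
  have "N (wcomp u f h) \<le> C * N h" if h: "h \<in> V" for h
  proof (cases "N h = 0")
    case True
    then have "h = (\<lambda>x. 0)" using quasi_norm_eq_0D[OF V(2) h] by simp
    then show ?thesis using True by (simp add: wcomp_def)
  next
    case False
    then have pos: "N h > 0" using quasi_norm_pos[OF V(2) h] by simp
    let ?c = "complex_of_real (1 / N h)"
    have "wcomp u f (\<lambda>x. ?c * h x) \<in> Q"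
      using Q(2) quasi_norm_normalise[OF V h pos] by simp
    from C[OF this] have "N (\<lambda>x. ?c * wcomp u f h x) \<le> C" by (simp only: wcomp_scale)
    then show ?thesis
      using pos by (simp only: quasi_norm_scale[OF V(2) inV[OF h]]) (simp add: norm_divide field_simps)
  qed
  then show ?thesis using dom unfolding wcomp_bounded_def by blast
qed

text \<open>
  The power \<open>(u C\<^sub>f)\<^sup>r\<close> is one application of the compact operator after a bounded one; the functions
  \<open>y j\<close> are the images under the bounded factor, scaled back into the unit ball.
\<close>

lemma wcomp_compact_funpow_not_separated:
  assumes V: "complex_function_space V" "quasi_norm_on V N" and c: "wcomp_compact V N u f"
    and r: "r \<ge> 1" and x: "\<And>j::nat. x j \<in> V \<and> N (x j) \<le> 1" and \<delta>: "\<delta> > 0"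
  shows "\<exists>j k. j < k \<and>
    N (\<lambda>z. (wcomp u f ^^ r) (x j) z - (wcomp u f ^^ r) (x k) z) < \<delta>"
proof -
  obtain Q where Q: "compactin (quasi_norm_topology V N) Q"
    "\<And>h. h \<in> V \<Longrightarrow> N h \<le> 1 \<Longrightarrow> wcomp u f h \<in> Q"
    using wcomp_compact_imp_compact_set[OF V(1) c] by blast
  note b = wcomp_compact_imp_bounded[OF V c]
  then have inV: "wcomp u f h \<in> V" if "h \<in> V" for h
    using that unfolding wcomp_bounded_def wcomp_domain_def by blast
  obtain s where s: "r = Suc s" using r by (cases r) auto
  obtain C where C: "C > 0"
    "\<And>h. h \<in> V \<Longrightarrow> (wcomp u f ^^ s) h \<in> V \<and> N ((wcomp u f ^^ s) h) \<le> C * N h"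
    using wcomp_bounded_funpow[OF V(2) b] by blast
  define y where "y = (\<lambda>j z. of_real (1 / C) * (wcomp u f ^^ s) (x j) z)"
  have y: "y j \<in> V" "N (y j) \<le> 1" for j
  proof -
    have xs: "(wcomp u f ^^ s) (x j) \<in> V" "N ((wcomp u f ^^ s) (x j)) \<le> C * N (x j)"
      using C(2) x by blast+
    show "y j \<in> V" unfolding y_def using complex_function_space_scale[OF V(1) xs(1)] .
    have "N (y j) = cmod (of_real (1 / C)) * N ((wcomp u f ^^ s) (x j))"
      unfolding y_def using quasi_norm_scale[OF V(2) xs(1)] .
    also have "\<dots> \<le> (1 / C) * (C * N (x j))"
      using xs(2) C(1) by (simp add: norm_divide field_simps)
    also have "\<dots> \<le> 1" using x C(1) by simp
    finally show "N (y j) \<le> 1" .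
  qed
  have "\<delta> / C > 0" using \<delta> C by simp
  then obtain j k where jk: "j < k"
    "N (\<lambda>z. wcomp u f (y j) z - wcomp u f (y k) z) < \<delta> / C"
    using compactin_quasi_norm_not_separated[OF V Q(1), of "\<lambda>j. wcomp u f (y j)" "\<delta> / C"]
      Q(2)[OF y] by auto
  have "(wcomp u f ^^ r) (x j) z = of_real C * wcomp u f (y j) z" for j z
    using C(1) by (simp add: s wcomp_def y_def)
  then have "N (\<lambda>z. (wcomp u f ^^ r) (x j) z - (wcomp u f ^^ r) (x k) z) =
      N (\<lambda>z. of_real C * (wcomp u f (y j) z - wcomp u f (y k) z))"
    by (simp add: right_diff_distrib)
  also have "\<dots> = cmod (of_real C) * N (\<lambda>z. wcomp u f (y j) z - wcomp u f (y k) z)"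
    using quasi_norm_scale[OF V(2) complex_function_space_diff[OF V(1) inV[OF y(1)] inV[OF y(1)]]] .
  also have "\<dots> < \<delta>" using jk(2) C(1) by (simp add: field_simps)
  finally show ?thesis using jk(1) by blast
qed

section \<open>Eigenvalues at a periodic point\<close>

context chart_at
begin

text \<open>
  The filtration by order of vanishing and the leading coefficients in the direction of an
  eigenvector satisfy the abstract axioms.  Boundedness of the functionals is Cauchy's estimate
  combined with the continuity of the inclusion of \<open>V\<close>.
\<close>

lemma graded_eigenfunctionals_wcomp:
  assumes V: "complex_function_space V" "quasi_norm_on V N" and inc: "continuous_inclusion A V N"
    and g: "isCont g p" "g p = p" "((\<lambda>z. \<phi> (g (\<psi> z))) has_derivative D) (at (\<phi> p))"
      "\<And>c v. D (c *s v) = c *s D v"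
    and v: "D v = \<alpha> *s v" "\<alpha> \<noteq> 0" and w: "isCont w p"
    and T: "\<And>h. h \<in> V \<Longrightarrow> wcomp w g h \<in> V"
  shows "graded_eigenfunctionals V N (wcomp w g) (\<lambda>n. {h \<in> V. vanishes_to_order n h})
    (leading v) (\<lambda>n. w p * \<alpha> ^ n)"
proof
  have hol: "h \<in> hol_funs A" if "h \<in> V" for h
    using inc that unfolding continuous_inclusion_def by blast
  have lim: "((\<lambda>t. h (line v t) / t ^ n) \<longlongrightarrow> leading v n h) (at 0)"
    if "h \<in> {h \<in> V. vanishes_to_order n h}" for h n
    using that leading_tendsto hol by blast
  show "complex_function_space V" "quasi_norm_on V N" by (fact V)+
  fix n m h k c
  show "{h \<in> V. vanishes_to_order n h} \<subseteq> V" by blast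
  show "m \<le> n \<Longrightarrow> {h \<in> V. vanishes_to_order n h} \<subseteq> {h \<in> V. vanishes_to_order m h}"
    using vanishes_to_order_antimono by blast
  show "\<exists>B. \<forall>h\<in>{h \<in> V. vanishes_to_order n h}. cmod (leading v n h) \<le> B * N h"
  proof -
    obtain K \<rho> where K: "compact K" "\<rho> > 0"
      "\<And>h n M. h \<in> hol_funs A \<Longrightarrow> vanishes_to_order n h \<Longrightarrow> \<forall>x\<in>K. cmod (h x) \<le> M \<Longrightarrow>
         cmod (leading v n h) \<le> M / \<rho> ^ n"
      using leading_Cauchy_bound[of v] by blast
    obtain C where C: "\<And>h x. h \<in> V \<Longrightarrow> x \<in> K \<Longrightarrow> cmod (h x) \<le> C * N h"
      using continuous_inclusion_sup_bound[OF V inc K(1)] by blast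
    have "cmod (leading v n h) \<le> (C / \<rho> ^ n) * N h"
      if "h \<in> {h \<in> V. vanishes_to_order n h}" for h
      using K(3)[of h n "C * N h"] C hol that by simp
    then show ?thesis by blast
  qed
  assume h: "h \<in> {h \<in> V. vanishes_to_order n h}"
  then have hV: "h \<in> V" "vanishes_to_order n h" by auto
  show "(\<lambda>x. c * h x) \<in> {h \<in> V. vanishes_to_order n h}"
    using complex_function_space_scale[OF V(1) hV(1)] vanishes_to_order_scale[OF hV(2)] by simp
  show "wcomp w g h \<in> {h \<in> V. vanishes_to_order n h}"
    using T[OF hV(1)] vanishes_to_order_wcomp[OF g w hV(2)] by simp
  show "leading v n (\<lambda>x. c * h x) = c * leading v n h"
    using tendsto_mult_left[OF lim[OF h], of c] by (intro leading_eqI) simp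
  show "leading v n (wcomp w g h) = w p * \<alpha> ^ n * leading v n h"
    using leading_wcomp[OF g v w hol[OF hV(1)] hV(2)] by (rule leading_eqI)
  show "m < n \<Longrightarrow> leading v m h = 0"
    using leading_eq_0[OF hV(2)] by (intro leading_eqI) simp
  assume k: "k \<in> {h \<in> V. vanishes_to_order n h}"
  then have kV: "k \<in> V" "vanishes_to_order n k" by auto
  show "(\<lambda>x. h x - k x) \<in> {h \<in> V. vanishes_to_order n h}"
    using complex_function_space_diff[OF V(1) hV(1) kV(1)] vanishes_to_order_diff[OF hV(2) kV(2)]
    by simp
  show "leading v n (\<lambda>x. h x - k x) = leading v n h - leading v n k"
    using tendsto_diff[OF lim[OF h] lim[OF k]] by (intro leading_eqI) (simp add: diff_divide_distrib)
qed

text \<open>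
  The image of the class of \<open>(\<phi>\<^sub>i - \<phi>\<^sub>i(p))\<^sup>n\<close> does not vanish in the direction \<open>v\<close> if \<open>v\<^sub>i \<noteq> 0\<close>, and by
  hypothesis it is the class of an element of \<open>V\<close>.  The choice of this power instead of a
  polynomial that is an eigenvector of the pull-back avoids left eigenvectors of the Jacobian.
\<close>

lemma exists_leading_nonzero:
  assumes inc: "continuous_inclusion A V N"
    and g: "isCont g p" "g p = p" "((\<lambda>z. \<phi> (g (\<psi> z))) has_derivative D) (at (\<phi> p))"
      "\<And>c v. D (c *s v) = c *s D v"
    and v: "D v = \<alpha> *s v" "\<alpha> \<noteq> 0" "v \<noteq> 0" and w: "isCont w p" "w p \<noteq> 0"
    and gr: "gr_map A p n w g ` gr_space A (g p) n \<subseteq> V_gr A V p n"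
  shows "\<exists>h\<in>{h \<in> V. vanishes_to_order n h}. leading v n h \<noteq> 0"
proof -
  obtain i where i: "v $ i \<noteq> 0" using v(3) by (auto simp: vec_eq_iff)
  define q where "q = (\<lambda>x. (\<phi> x $ i - \<phi> p $ i) ^ n)"
  have "germ_at p q \<in> max_ideal_pow A p n"
    unfolding q_def by (rule germ_power_in_max_ideal_pow[OF coordinate_in_max_ideal])
  then obtain h where h: "h \<in> V" "vanishes_to_order n h"
    "vanishes_to_order (Suc n) (\<lambda>x. wcomp w g q x - h x)"
    using graded_image_lift[OF gr g(2)] by blast
  have "((\<lambda>t. wcomp w g q (line v t) / t ^ n) \<longlongrightarrow> w p * (\<alpha> * v $ i) ^ n) (at 0)"
    unfolding q_def using leading_wcomp_coordinate_power[OF g v(1) w(1)] .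
  from tendsto_diff[OF this leading_eq_0[OF h(3) lessI, of v]]
  have "((\<lambda>t. h (line v t) / t ^ n) \<longlongrightarrow> w p * (\<alpha> * v $ i) ^ n) (at 0)"
    by (simp add: diff_divide_distrib)
  then have "leading v n h = w p * (\<alpha> * v $ i) ^ n" by (rule leading_eqI)
  then have "leading v n h \<noteq> 0" using w(2) v(2) i by simp
  then show ?thesis using h by blast
qed

text \<open>
  The weighted composition operator of the \<open>r\<close>-th iterate is the \<open>r\<close>-th power of \<open>u C\<^sub>f\<close>, and \<open>p\<close> is a
  fixed point of that iterate.  The directions in which leading coefficients are taken are the eigenvectors
  of the Jacobian matrix for \<open>\<alpha>\<close>.
\<close>

lemma eigenfunctionals_at_periodic_point:
  assumes f: "holomorphic_self_map A f" and u: "u \<in> hol_funs A"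
    and V: "quasi_Banach V N" and inc: "continuous_inclusion A V N"
    and p: "(f ^^ r) p = p"
    and w: "w = (\<lambda>x. \<Prod>j<r. u ((f ^^ j) x))" "w p \<noteq> 0"
    and dom: "wcomp_domain V u f = V"
    and \<alpha>: "matrix_eigenvalue (chart_jacobian (U, \<phi>) (f ^^ r) p) \<alpha>" "\<alpha> \<noteq> 0"
  shows "\<exists>v.
    graded_eigenfunctionals V N (wcomp u f ^^ r) (\<lambda>n. {h \<in> V. vanishes_to_order n h})
      (leading v) (\<lambda>n. w p * \<alpha> ^ n) \<and>
    (\<forall>n. gr_map A p n w (f ^^ r) ` gr_space A ((f ^^ r) p) n \<subseteq> V_gr A V p n \<longrightarrow>
      (\<exists>h\<in>{h \<in> V. vanishes_to_order n h}. leading v n h \<noteq> 0))"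
proof -
  let ?g = "f ^^ r"
  have V': "complex_function_space V" "quasi_norm_on V N"
    using V by (auto simp: quasi_Banach_def)
  have T: "wcomp u f ^^ r = wcomp w ?g" unfolding w(1) using wcomp_funpow by blast
  have inV: "wcomp u f h \<in> V" if "h \<in> V" for h
    using dom that unfolding wcomp_domain_def by blast
  have TV: "wcomp w ?g h \<in> V" if h: "h \<in> V" for h
  proof -
    have "(wcomp u f ^^ r) h \<in> V" by (induction r) (use h inV in auto)
    then show ?thesis by (simp add: T)
  qed
  note funpow = holomorphic_self_map_funpow[OF manifold f]
  have cont: "isCont (f ^^ j) x" for j x
    using funpow(1) by (simp add: continuous_on_eq_continuous_at)
  have ucont: "isCont u x" for x
  proof -
    have "x \<in> (\<Union>(U, \<phi>)\<in>A. U)" using manifold unfolding complex_manifold_def by simp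
    then obtain Z \<xi> where "(Z, \<xi>) \<in> A" "x \<in> Z" by blast
    then interpret Z: chart_at A Z \<xi> x using manifold by unfold_locales
    show ?thesis using Z.holomorphic_fun_isCont[of UNIV u] u by (simp add: hol_funs_def)
  qed
  have wcont: "isCont w p"
    unfolding w(1) by (intro continuous_prod isCont_o2[OF cont ucont])
  obtain D where D: "((\<lambda>z. \<phi> (?g (\<psi> z))) has_derivative D) (at (\<phi> p))"
    "\<And>c v. D (c *s v) = c *s D v"
    using complex_differentiable_mapD[OF funpow(2) chart chart p_in] p p_in by metis
  have "chart_jacobian (U, \<phi>) ?g p = matrix D"
    using frechet_derivative_at[OF D(1)] by (simp add: chart_jacobian_def jacobian_def)
  then obtain v where v: "v \<noteq> 0" "D v = \<alpha> *s v"
    using \<alpha>(1) matrix_mult_complex_linear[OF has_derivative_bounded_linear[OF D(1)] D(2)]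
    unfolding matrix_eigenvalue_def by auto
  show ?thesis
  proof (intro exI[of _ v] conjI allI impI)
    show "graded_eigenfunctionals V N (wcomp u f ^^ r) (\<lambda>n. {h \<in> V. vanishes_to_order n h})
       (leading v) (\<lambda>n. w p * \<alpha> ^ n)"
      unfolding T
      using graded_eigenfunctionals_wcomp[OF V' inc cont p D v(2) \<alpha>(2) wcont TV] .
    show "\<exists>h\<in>{h \<in> V. vanishes_to_order n h}. leading v n h \<noteq> 0"
      if "gr_map A p n w ?g ` gr_space A (?g p) n \<subseteq> V_gr A V p n" for n
      using exists_leading_nonzero[OF inc cont p D v(2) \<alpha>(2) v(1) wcont w(2) that] .
  qed
qed

end

theorem theorem1p3:
  fixes A :: "('a::t2_space, 'n::finite) atlas"
    and f :: "'a \<Rightarrow> 'a"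
    and u :: "'a \<Rightarrow> complex"
    and V :: "('a \<Rightarrow> complex) set"
    and N :: "('a \<Rightarrow> complex) \<Rightarrow> real"
    and p :: 'a
    and r :: nat
    and u_r :: "'a \<Rightarrow> complex"
  assumes "complex_manifold A"
    and "connected (UNIV :: 'a set)"
    and "holomorphic_self_map A f"
    and "u \<in> hol_funs A"
    and "quasi_Banach V N"
    and "continuous_inclusion A V N"
    and "r \<ge> 1" and "(f ^^ r) p = p"
    and "u_r = (\<lambda>x. \<Prod>j<r. u ((f ^^ j) x))"
    and "u_r p \<noteq> 0"
    and "infinite {n. n \<ge> 1 \<and>
           gr_map A p n u_r (f ^^ r) ` gr_space A ((f ^^ r) p) n \<subseteq> V_gr A V p n}"
  shows "(wcomp_bounded V N u f \<longrightarrow>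
            (\<forall>(U, \<phi>)\<in>A. p \<in> U \<longrightarrow>
               (\<forall>\<alpha>. matrix_eigenvalue (chart_jacobian (U, \<phi>) (f ^^ r) p) \<alpha> \<longrightarrow> cmod \<alpha> \<le> 1))) \<and>
         (wcomp_compact V N u f \<longrightarrow>
            (\<forall>(U, \<phi>)\<in>A. p \<in> U \<longrightarrow>
               (\<forall>\<alpha>. matrix_eigenvalue (chart_jacobian (U, \<phi>) (f ^^ r) p) \<alpha> \<longrightarrow> cmod \<alpha> < 1)))"
proof (intro conjI impI ballI; clarify)
  let ?I = "{n. n \<ge> 1 \<and> gr_map A p n u_r (f ^^ r) ` gr_space A ((f ^^ r) p) n \<subseteq> V_gr A V p n}"
  have V: "complex_function_space V" "quasi_norm_on V N"
    using assms(5) by (auto simp: quasi_Banach_def)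
  fix U \<phi> \<alpha>
  assume chart: "(U, \<phi>) \<in> A" "p \<in> U"
    and \<alpha>: "matrix_eigenvalue (chart_jacobian (U, \<phi>) (f ^^ r) p) \<alpha>"
  interpret chart_at A U \<phi> p using assms(1) chart by unfold_locales
  note core = eigenfunctionals_at_periodic_point[OF assms(3-6,8-10) _ \<alpha>]
  show "cmod \<alpha> \<le> 1" if b: "wcomp_bounded V N u f"
  proof (rule ccontr)
    assume "\<not> cmod \<alpha> \<le> 1"
    then have \<alpha>1: "cmod \<alpha> > 1" "\<alpha> \<noteq> 0" by auto
    have dom: "wcomp_domain V u f = V" using b by (simp add: wcomp_bounded_def)
    obtain v where v:
      "graded_eigenfunctionals V N (wcomp u f ^^ r) (\<lambda>n. {h \<in> V. vanishes_to_order n h})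
         (leading v) (\<lambda>n. u_r p * \<alpha> ^ n)"
      "\<And>n. gr_map A p n u_r (f ^^ r) ` gr_space A ((f ^^ r) p) n \<subseteq> V_gr A V p n \<Longrightarrow>
         \<exists>h\<in>{h \<in> V. vanishes_to_order n h}. leading v n h \<noteq> 0"
      using core[OF dom \<alpha>1(2)] by blast
    interpret graded_eigenfunctionals V N "wcomp u f ^^ r"
      "\<lambda>n. {h \<in> V. vanishes_to_order n h}" "leading v" "\<lambda>n. u_r p * \<alpha> ^ n"
      by (rule v(1))
    obtain C where C: "C > 0" "\<And>h. h \<in> V \<Longrightarrow> N ((wcomp u f ^^ r) h) \<le> C * N h"
      using wcomp_bounded_funpow[OF V(2) b] by blast
    \<comment> \<open>The eigenvalues \<open>u\<^sub>r(p) \<alpha>\<^sup>n\<close> on the graded pieces would be unbounded.\<close>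
    obtain m where m: "2 * C / cmod (u_r p) < cmod \<alpha> ^ m"
      using real_arch_pow[OF \<alpha>1(1)] by blast
    obtain n where n: "n \<in> ?I" "m \<le> n"
      using assms(11) unfolding infinite_nat_iff_unbounded_le by blast
    have "cmod (u_r p * \<alpha> ^ n) \<le> 2 * C"
      using v(2)[of n] n(1) bounded_imp_eigenvalue_bound[OF less_imp_le[OF C(1)] C(2)] by blast
    then have "cmod \<alpha> ^ n \<le> 2 * C / cmod (u_r p)"
      using assms(10) by (simp add: norm_mult norm_power field_simps)
    moreover have "cmod \<alpha> ^ m \<le> cmod \<alpha> ^ n" using \<alpha>1 n(2) by (intro power_increasing) auto
    ultimately show False using m by linarith
  qed
  show "cmod \<alpha> < 1" if c: "wcomp_compact V N u f"
  proof (rule ccontr)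
    assume "\<not> cmod \<alpha> < 1"
    then have \<alpha>1: "cmod \<alpha> \<ge> 1" "\<alpha> \<noteq> 0" by auto
    have dom: "wcomp_domain V u f = V" using c by (simp add: wcomp_compact_def)
    obtain v where v:
      "graded_eigenfunctionals V N (wcomp u f ^^ r) (\<lambda>n. {h \<in> V. vanishes_to_order n h})
         (leading v) (\<lambda>n. u_r p * \<alpha> ^ n)"
      "\<And>n. gr_map A p n u_r (f ^^ r) ` gr_space A ((f ^^ r) p) n \<subseteq> V_gr A V p n \<Longrightarrow>
         \<exists>h\<in>{h \<in> V. vanishes_to_order n h}. leading v n h \<noteq> 0"
      using core[OF dom \<alpha>1(2)] by blast
    interpret graded_eigenfunctionals V N "wcomp u f ^^ r"
      "\<lambda>n. {h \<in> V. vanishes_to_order n h}" "leading v" "\<lambda>n. u_r p * \<alpha> ^ n"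
      by (rule v(1))
    \<comment> \<open>None of the infinitely many eigenvalues \<open>u\<^sub>r(p) \<alpha>\<^sup>n\<close> is smaller than \<open>u\<^sub>r(p)\<close> in modulus.\<close>
    let ?J = "{n. (\<exists>h\<in>{h \<in> V. vanishes_to_order n h}. leading v n h \<noteq> 0) \<and>
      cmod (u_r p * \<alpha> ^ n) \<ge> cmod (u_r p)}"
    have "finite ?J"
      using wcomp_compact_funpow_not_separated[OF V c assms(7)] assms(10)
      by (intro compact_imp_finitely_many_large_eigenvalues) auto
    moreover have "?I \<subseteq> ?J"
      using v(2) one_le_power[OF \<alpha>1(1)] by (auto simp: norm_mult norm_power mult_le_cancel_left1)
    ultimately show False using assms(11) finite_subset by blast
  qed
qed

end
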